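(* Let $q\in\mathbb C$ with $|q|=1$. The noncommutative torus $A=C^\infty(T^2_q)$ is a smooth $*$-algebra; that is, there exist a set $\mathcal S$ of positive linear forms on $A$ and a set $\mathcal D\subset\operatorname{Der}(A)$ such that $A$ is a smooth $*$-algebra relative to $\mathcal S$ and $\mathcal D$. Moreover $\mathcal S$ and $\mathcal D$ can be chosen such that the smooth topology $\tau(\mathcal S,\mathcal D)$ is the original Fréchet topology of $C^\infty(T^2_q)$.
   Context: A $*$-algebra is a complex associative unital algebra with an antilinear involution $f\mapsto f^*$ satisfying $(fg)^*=g^*f^*$. A linear form $\varphi$ on a $*$-algebra $A$ is positive if $\varphi(f^*f)\ge0$ for all $f\in A$; the set of positive linear forms is $A^*_+$. $A$ acts on $A^*_+$ by $(f,\varphi)\mapsto\varphi_f$, $\varphi_f(g)=\varphi(f^*gf)$. $\operatorname{Der}(A)$ is the Lie algebra of derivations of $A$ and $Z(A)$ is the center of $A$. Let $\mathcal S\subset A^*_+$ be invariant under the action of $A$, and let $\mathcal D$ be a Lie subalgebra of $\operatorname{Der}(A)$ which is also a $Z(A)$-submodule. $A$ is called a smooth $*$-algebra relative to $\mathcal S$ and $\mathcal D$ if: (1) the locally convex topology on $A$ generated by the seminorms $\nu_\varphi(f)=(\varphi(f^*f))^{1/2}$, $\varphi\in\mathcal S$, is Hausdorff; (2) $\bigcap\{\ker X: X\in\mathcal D\}=\mathbb C1$; (3) the locally convex topology $\tau(\mathcal S,\mathcal D)$ on $A$ generated by the seminorms $\nu_\varphi\circ X_1\circ\cdots\circ X_p$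 with $\varphi\in\mathcal S$, $X_i\in\mathcal D$, $p\in\mathbb N$ ($p=0$ included), is complete. Then $\tau(\mathcal S,\mathcal D)$ is called the smooth topology. $C^\infty(T^2_q)$ is the algebra of all series $f=\sum_{(k,l)\in\mathbb Z^2}f_{k,l}U^kV^l$ with complex coefficients such that $\|f\|_m:=\sup_{k,l}|f_{k,l}|(1+|k|+|l|)^m<\infty$ for all $m\in\mathbb N$, with $U,V$ invertible and $UV=qVU$, with involution determined by $U^*=U^{-1}$, $V^*=V^{-1}$, and with the Fréchet topology given by the seminorms $\|\cdot\|_m$. *)

theory Defs
  imports "HOL-Algebra.Module" "HOL-Analysis.Analysis"
begin

section \<open>Star-algebras\<close>

definition complex_ring :: "complex ring" where
  "complex_ring = \<lparr>carrier = UNIV, monoid.mult = (*), one = 1, zero = 0, add = (+)\<rparr>"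

record 'a star_alg = "(complex, 'a) module" +
  invol :: "'a \<Rightarrow> 'a"  (\<open>star\<index> _\<close> [90] 90)

locale star_algebra = ring A + Module.module complex_ring A for A (structure) +
  assumes smult_mult_left:
      "\<lbrakk>f \<in> carrier A; g \<in> carrier A\<rbrakk> \<Longrightarrow> (c \<odot> f) \<otimes> g = c \<odot> (f \<otimes> g)"
    and smult_mult_right:
      "\<lbrakk>f \<in> carrier A; g \<in> carrier A\<rbrakk> \<Longrightarrow> f \<otimes> (c \<odot> g) = c \<odot> (f \<otimes> g)"
    and star_closed: "f \<in> carrier A \<Longrightarrow> star f \<in> carrier A"
    and star_add:
      "\<lbrakk>f \<in> carrier A; g \<in> carrier A\<rbrakk> \<Longrightarrow> star (f \<oplus> g) = star f \<oplus> star g"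
    and star_smult: "f \<in> carrier A \<Longrightarrow> star (c \<odot> f) = cnj c \<odot> star f"
    and star_star: "f \<in> carrier A \<Longrightarrow> star (star f) = f"
    and star_mult:
      "\<lbrakk>f \<in> carrier A; g \<in> carrier A\<rbrakk> \<Longrightarrow> star (f \<otimes> g) = star g \<otimes> star f"

text \<open>Linear forms and derivations are represented by functions that are undefined
  outside the carrier, so that equality of functions is equality of maps.\<close>

definition linear_forms :: "('a, 'm) star_alg_scheme \<Rightarrow> ('a \<Rightarrow> complex) set" where
  "linear_forms A = {\<phi> \<in> extensional (carrier A).
     (\<forall>f\<in>carrier A. \<forall>g\<in>carrier A. \<phi> (f \<oplus>\<^bsub>A\<^esub> g) = \<phi> f + \<phi> g) \<and>
     (\<forall>c. \<forall>f\<in>carrier A. \<phi> (c \<odot>\<^bsub>A\<^esub> f) = c * \<phi> f)}"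

definition positive_forms :: "('a, 'm) star_alg_scheme \<Rightarrow> ('a \<Rightarrow> complex) set" where
  "positive_forms A =
     {\<phi> \<in> linear_forms A. \<forall>f\<in>carrier A. \<phi> (star\<^bsub>A\<^esub> f \<otimes>\<^bsub>A\<^esub> f) \<in> \<real>\<^sub>\<ge>\<^sub>0}"

definition form_action ::
  "('a, 'm) star_alg_scheme \<Rightarrow> 'a \<Rightarrow> ('a \<Rightarrow> complex) \<Rightarrow> 'a \<Rightarrow> complex" where
  "form_action A f \<phi> = (\<lambda>g\<in>carrier A. \<phi> (star\<^bsub>A\<^esub> f \<otimes>\<^bsub>A\<^esub> g \<otimes>\<^bsub>A\<^esub> f))"

definition form_seminorm ::
  "('a, 'm) star_alg_scheme \<Rightarrow> ('a \<Rightarrow> complex) \<Rightarrow> 'a \<Rightarrow> real" where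
  "form_seminorm A \<phi> f = sqrt (Re (\<phi> (star\<^bsub>A\<^esub> f \<otimes>\<^bsub>A\<^esub> f)))"

definition center :: "('a, 'm) star_alg_scheme \<Rightarrow> 'a set" where
  "center A = {z \<in> carrier A. \<forall>f\<in>carrier A. z \<otimes>\<^bsub>A\<^esub> f = f \<otimes>\<^bsub>A\<^esub> z}"

definition derivations :: "('a, 'm) star_alg_scheme \<Rightarrow> ('a \<Rightarrow> 'a) set" where
  "derivations A = {X \<in> carrier A \<rightarrow>\<^sub>E carrier A.
     (\<forall>f\<in>carrier A. \<forall>g\<in>carrier A. X (f \<oplus>\<^bsub>A\<^esub> g) = X f \<oplus>\<^bsub>A\<^esub> X g) \<and>
     (\<forall>c. \<forall>f\<in>carrier A. X (c \<odot>\<^bsub>A\<^esub> f) = c \<odot>\<^bsub>A\<^esub> X f) \<and>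
     (\<forall>f\<in>carrier A. \<forall>g\<in>carrier A.
        X (f \<otimes>\<^bsub>A\<^esub> g) = (X f \<otimes>\<^bsub>A\<^esub> g) \<oplus>\<^bsub>A\<^esub> (f \<otimes>\<^bsub>A\<^esub> X g))}"

definition lie_subalgebra_Der :: "('a, 'm) star_alg_scheme \<Rightarrow> ('a \<Rightarrow> 'a) set \<Rightarrow> bool" where
  "lie_subalgebra_Der A D \<longleftrightarrow> D \<subseteq> derivations A \<and>
     (\<lambda>f\<in>carrier A. \<zero>\<^bsub>A\<^esub>) \<in> D \<and>
     (\<forall>X\<in>D. \<forall>Y\<in>D. (\<lambda>f\<in>carrier A. X f \<oplus>\<^bsub>A\<^esub> Y f) \<in> D) \<and>
     (\<forall>c. \<forall>X\<in>D. (\<lambda>f\<in>carrier A. c \<odot>\<^bsub>A\<^esub> X f) \<in> D) \<and>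
     (\<forall>X\<in>D. \<forall>Y\<in>D. (\<lambda>f\<in>carrier A. X (Y f) \<ominus>\<^bsub>A\<^esub> Y (X f)) \<in> D)"

definition center_submodule_Der :: "('a, 'm) star_alg_scheme \<Rightarrow> ('a \<Rightarrow> 'a) set \<Rightarrow> bool" where
  "center_submodule_Der A D \<longleftrightarrow> D \<subseteq> derivations A \<and>
     (\<lambda>f\<in>carrier A. \<zero>\<^bsub>A\<^esub>) \<in> D \<and>
     (\<forall>X\<in>D. \<forall>Y\<in>D. (\<lambda>f\<in>carrier A. X f \<oplus>\<^bsub>A\<^esub> Y f) \<in> D) \<and>
     (\<forall>z\<in>center A. \<forall>X\<in>D. (\<lambda>f\<in>carrier A. z \<otimes>\<^bsub>A\<^esub> X f) \<in> D)"


section \<open>Locally convex topologies generated by seminorms\<close>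

text \<open>The carrier is added to the subbase so that the topology lives on all of \<open>carrier A\<close>
  even when the family \<open>P\<close> is empty.\<close>

definition seminorm_topology ::
  "('a, 'm) star_alg_scheme \<Rightarrow> ('a \<Rightarrow> real) set \<Rightarrow> 'a topology" where
  "seminorm_topology A P = topology_generated_by
     (insert (carrier A)
       {{g \<in> carrier A. p (g \<ominus>\<^bsub>A\<^esub> f) < e} | p f e. p \<in> P \<and> f \<in> carrier A \<and> e > 0})"

text \<open>Completeness of the associated uniform structure: every Cauchy filter converges.
  Sequential completeness would be weaker, since \<open>P\<close> may be uncountable.\<close>

definition seminorm_complete :: "('a, 'm) star_alg_scheme \<Rightarrow> ('a \<Rightarrow> real) set \<Rightarrow> bool" where
  "seminorm_complete A P \<longleftrightarrow>
     (\<forall>F. F \<noteq> bot \<longrightarrow> F \<le> principal (carrier A) \<longrightarrow>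
        (\<forall>p\<in>P. \<forall>e>0. \<forall>\<^sub>F (f, g) in F \<times>\<^sub>F F. p (f \<ominus>\<^bsub>A\<^esub> g) < e) \<longrightarrow>
        (\<exists>l. limitin (seminorm_topology A P) (\<lambda>f. f) l F))"


section \<open>Smooth star-algebras\<close>

definition smooth_seminorms ::
  "('a, 'm) star_alg_scheme \<Rightarrow> ('a \<Rightarrow> complex) set \<Rightarrow> ('a \<Rightarrow> 'a) set \<Rightarrow> ('a \<Rightarrow> real) set" where
  "smooth_seminorms A S D =
     {form_seminorm A \<phi> \<circ> foldr (\<circ>) Xs id | \<phi> Xs. \<phi> \<in> S \<and> Xs \<in> lists D}"

definition smooth_topology ::
  "('a, 'm) star_alg_scheme \<Rightarrow> ('a \<Rightarrow> complex) set \<Rightarrow> ('a \<Rightarrow> 'a) set \<Rightarrow> 'a topology" where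
  "smooth_topology A S D = seminorm_topology A (smooth_seminorms A S D)"

locale smooth_star_algebra = star_algebra A for A (structure) +
  fixes S :: "('a \<Rightarrow> complex) set" and D :: "('a \<Rightarrow> 'a) set"
  assumes forms_positive: "S \<subseteq> positive_forms A"
    and forms_invariant: "\<lbrakk>f \<in> carrier A; \<phi> \<in> S\<rbrakk> \<Longrightarrow> form_action A f \<phi> \<in> S"
    and lie_subalgebra: "lie_subalgebra_Der A D"
    and center_submodule: "center_submodule_Der A D"
    and hausdorff: "Hausdorff_space (seminorm_topology A (form_seminorm A ` S))"
    and common_kernel: "{f \<in> carrier A. \<forall>X\<in>D. X f = \<zero>} = range (\<lambda>c. c \<odot> \<one>)"
    and complete: "seminorm_complete A (smooth_seminorms A S D)"


section \<open>The noncommutative torus\<close>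

text \<open>A series \<open>\<Sum> f\<^sub>k\<^sub>l U\<^sup>k V\<^sup>l\<close> is represented by its coefficient function \<open>f :: int \<times> int \<Rightarrow> complex\<close>.\<close>

definition torus_weighted :: "nat \<Rightarrow> (int \<times> int \<Rightarrow> complex) \<Rightarrow> int \<times> int \<Rightarrow> real" where
  "torus_weighted m f = (\<lambda>(k, l). cmod (f (k, l)) * (1 + \<bar>real_of_int k\<bar> + \<bar>real_of_int l\<bar>) ^ m)"

definition torus_norm :: "nat \<Rightarrow> (int \<times> int \<Rightarrow> complex) \<Rightarrow> real" where
  "torus_norm m f = (SUP kl. torus_weighted m f kl)"

text \<open>Since \<open>V\<^sup>l U\<^sup>a = q\<^sup>-\<^sup>l\<^sup>a U\<^sup>a V\<^sup>l\<close>, one has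
  \<open>(U\<^sup>k V\<^sup>l) (U\<^sup>a V\<^sup>b) = q\<^sup>-\<^sup>l\<^sup>a U\<^sup>k\<^sup>+\<^sup>a V\<^sup>l\<^sup>+\<^sup>b\<close> and
  \<open>(U\<^sup>k V\<^sup>l)\<^sup>* = V\<^sup>-\<^sup>l U\<^sup>-\<^sup>k = q\<^sup>-\<^sup>k\<^sup>l U\<^sup>-\<^sup>k V\<^sup>-\<^sup>l\<close>; this gives the coefficients below.\<close>

definition nc_torus :: "complex \<Rightarrow> (int \<times> int \<Rightarrow> complex) star_alg" where
  "nc_torus q =
     \<lparr>carrier = {f. \<forall>m. bdd_above (range (torus_weighted m f))},
      monoid.mult = (\<lambda>f g (m, n).
        \<Sum>\<^sub>\<infinity>(k, l)\<in>UNIV. f (k, l) * g (m - k, n - l) * q powi (- l * (m - k))),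
      one = (\<lambda>kl. if kl = (0, 0) then 1 else 0),
      zero = (\<lambda>_. 0),
      add = (\<lambda>f g kl. f kl + g kl),
      module.smult = (\<lambda>c f kl. c * f kl),
      invol = (\<lambda>f (m, n). cnj (f (- m, - n)) * q powi (- (m * n)))\<rparr>"

definition torus_monom :: "int \<Rightarrow> int \<Rightarrow> int \<times> int \<Rightarrow> complex" where
  "torus_monom k l = (\<lambda>ab. if ab = (k, l) then 1 else 0)"

abbreviation torus_U :: "int \<times> int \<Rightarrow> complex" where "torus_U \<equiv> torus_monom 1 0"

abbreviation torus_V :: "int \<times> int \<Rightarrow> complex" where "torus_V \<equiv> torus_monom 0 1"

definition torus_frechet_topology :: "complex \<Rightarrow> (int \<times> int \<Rightarrow> complex) topology" where
  "torus_frechet_topology q = seminorm_topology (nc_torus q) (range torus_norm)"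

text \<open>The multiplication and involution of \<open>nc_torus q\<close> satisfy the defining relations.\<close>

lemma torus_one: "\<one>\<^bsub>nc_torus q\<^esub> = torus_monom 0 0"
  by (simp add: nc_torus_def torus_monom_def)

lemma torus_monom_mult:
  "torus_monom k l \<otimes>\<^bsub>nc_torus q\<^esub> torus_monom a b =
     (q powi (- l * a)) \<odot>\<^bsub>nc_torus q\<^esub> torus_monom (k + a) (l + b)"
proof
  fix mn :: "int \<times> int"
  obtain m n where mn: "mn = (m, n)" by (cases mn)
  have "(\<Sum>\<^sub>\<infinity>(k', l')\<in>UNIV. torus_monom k l (k', l') * torus_monom a b (m - k', n - l')
           * q powi (- l' * (m - k'))) =
        (\<Sum>\<^sub>\<infinity>(k', l')\<in>{(k, l)}. torus_monom k l (k', l') * torus_monom a b (m - k', n - l')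
           * q powi (- l' * (m - k')))"
    by (rule infsum_cong_neutral) (auto simp: torus_monom_def split: if_splits)
  then show "(torus_monom k l \<otimes>\<^bsub>nc_torus q\<^esub> torus_monom a b) mn =
     ((q powi (- l * a)) \<odot>\<^bsub>nc_torus q\<^esub> torus_monom (k + a) (l + b)) mn"
    by (auto simp: nc_torus_def torus_monom_def mn)
qed

lemma torus_UV:
  assumes "cmod q = 1"
  shows "torus_U \<otimes>\<^bsub>nc_torus q\<^esub> torus_V = q \<odot>\<^bsub>nc_torus q\<^esub> (torus_V \<otimes>\<^bsub>nc_torus q\<^esub> torus_U)"
proof -
  have "q \<noteq> 0" using assms by auto
  then show ?thesis
    by (subst (1 2) torus_monom_mult) (simp add: nc_torus_def power_int_minus fun_eq_iff)
qed

lemma torus_U_V_power: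
  "torus_monom k 0 \<otimes>\<^bsub>nc_torus q\<^esub> torus_monom 0 l = torus_monom k l"
  "torus_monom k 0 \<otimes>\<^bsub>nc_torus q\<^esub> torus_monom k' 0 = torus_monom (k + k') 0"
  "torus_monom 0 l \<otimes>\<^bsub>nc_torus q\<^esub> torus_monom 0 l' = torus_monom 0 (l + l')"
  by (subst torus_monom_mult, simp add: nc_torus_def)+

lemma torus_star_U_V:
  "star\<^bsub>nc_torus q\<^esub> torus_U = torus_monom (-1) 0"
  "star\<^bsub>nc_torus q\<^esub> torus_V = torus_monom 0 (-1)"
  by (auto simp: nc_torus_def torus_monom_def fun_eq_iff)

end

theory Submission
  imports Defs
begin

text \<open>
  The original topology is recovered by letting \<open>S\<close> and \<open>D\<close> be as large as continuity permits:
  \<open>S\<close> consists of all positive forms bounded by a multiple of some norm \<open>torus_norm n\<close>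
  (\<open>bounded_forms\<close>), and \<open>D\<close> of all derivations that are continuous for these norms
  (\<open>bounded_derivations\<close>). With this choice the closure conditions are formal. Multiplication and
  involution are continuous (\<open>conv_norm\<close>, \<open>conv_star_norm\<close>), so the action of the algebra preserves
  continuity of forms, and sums, commutators and central multiples of continuous derivations are
  continuous, whether the centre is trivial or, for \<open>q\<close> a root of unity, large. Every
  seminorm of the smooth topology is then automatically bounded by a Frechet norm (\<open>smooth_dominated\<close>).

  The converse estimate, the kernel condition and the Hausdorff property need only three elements of
  these sets: the trace \<open>\<tau> f = f\<^sub>0\<^sub>0\<close> and the derivations that multiply the coefficient \<open>f\<^sub>k\<^sub>l\<close>
  by \<open>k\<close> and by \<open>l\<close>. Since \<open>\<tau> (f\<^sup>* f)\<close> is the sum of the \<open>\<bar>f\<^sub>k\<^sub>l\<bar>\<^sup>2\<close>, the trace seminorm of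
  \<open>f\<close> bounds every coefficient of \<open>f\<close>; applied to the \<open>m\<close>-th powers of the two derivations it bounds
  \<open>\<bar>k\<bar>\<^sup>m \<bar>f\<^sub>k\<^sub>l\<bar>\<close> and \<open>\<bar>l\<bar>\<^sup>m \<bar>f\<^sub>k\<^sub>l\<bar>\<close>, hence the \<open>m\<close>-th Frechet norm (\<open>torus_norm_dominated\<close>). So
  the two families of seminorms generate the same topology and have the same Cauchy filters, and
  completeness is inherited from the Frechet space, where it is proved by coefficientwise limits
  (\<open>torus_norm_complete\<close>).

  Two pieces of groundwork precede this: the twisted convolution of rapidly decreasing
  coefficients is again rapidly decreasing and is associative (Fubini and the cocycle identity), and
  the seminorm attached to a positive form satisfies the triangle inequality (Cauchy-Schwarz).
\<close>

section \<open>Topologies generated by seminorms\<close>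

definition subadditive :: "('a, 'm) star_alg_scheme \<Rightarrow> ('a \<Rightarrow> real) set \<Rightarrow> bool" where
  "subadditive A P \<longleftrightarrow> (\<forall>p\<in>P. p \<zero>\<^bsub>A\<^esub> = 0 \<and>
     (\<forall>f\<in>carrier A. \<forall>g\<in>carrier A. p (f \<oplus>\<^bsub>A\<^esub> g) \<le> p f + p g))"

text \<open>For families of genuine seminorms this says that each \<open>p\<close> in \<open>P\<close> is bounded by a multiple of
  a maximum of finitely many members of \<open>Q\<close>, that is, that the identity is continuous from the topology
  of \<open>Q\<close> to that of \<open>P\<close>. The \<open>\<epsilon>\<close>-\<open>\<delta>\<close> form avoids naming the constant.\<close>
definition dominated ::
  "('a, 'm) star_alg_scheme \<Rightarrow> ('a \<Rightarrow> real) set \<Rightarrow> ('a \<Rightarrow> real) set \<Rightarrow> bool" where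
  "dominated A P Q \<longleftrightarrow> (\<forall>p\<in>P. \<forall>e>0. \<exists>Q0 d. finite Q0 \<and> Q0 \<subseteq> Q \<and> d > 0 \<and>
     (\<forall>f\<in>carrier A. (\<forall>q\<in>Q0. q f < d) \<longrightarrow> p f < e))"

context star_algebra
begin

lemma ring_A: "ring A"
  using star_algebra_axioms by (simp add: star_algebra_def)

text \<open>In this locale the unqualified ring facts refer to the scalars, so those of the algebra itself are
  given a name of their own.\<close>
lemmas alg_simps = ring.ring_simprules[OF ring_A]
lemmas alg_closed [simp] = alg_simps(1-6)

lemma diff_self [simp]: "h \<in> carrier A \<Longrightarrow> h \<ominus> h = \<zero>"
  by (simp add: alg_simps)

lemma minus_eq_zero_iff:
  assumes "f \<in> carrier A" "g \<in> carrier A"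
  shows "f \<ominus> g = \<zero> \<longleftrightarrow> f = g"
proof
  assume "f \<ominus> g = \<zero>"
  then have "(f \<ominus> g) \<oplus> g = g" using assms by (simp add: alg_simps(8))
  then show "f = g" using assms by (simp add: alg_simps(7,9,14,15))
qed (use assms in simp)

lemma minus_split:
  assumes "f \<in> carrier A" "g \<in> carrier A" "h \<in> carrier A"
  shows "f \<ominus> g = (f \<ominus> h) \<oplus> (h \<ominus> g)"
proof -
  have "(f \<ominus> h) \<oplus> (h \<ominus> g) = f \<oplus> (\<ominus> h \<oplus> (h \<oplus> \<ominus> g))"
    using assms by (simp add: alg_simps(7,14))
  also have "\<dots> = f \<ominus> g"
    using assms by (simp add: alg_simps(14,18))
  finally show ?thesis by simp
qed

text \<open>The generating sets are balls around arbitrary centres. By subadditivity such a ball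
  contains a smaller ball around each of its points, so the open sets can be tested with
  finite intersections of balls around the point in question. Comparison of topologies and convergence
  both reduce to this description.\<close>
lemma openin_seminorm_topology:
  assumes P: "subadditive A P"
  shows "openin (seminorm_topology A P) U \<longleftrightarrow> U \<subseteq> carrier A \<and>
    (\<forall>h\<in>U. \<exists>P0 d. finite P0 \<and> P0 \<subseteq> P \<and> d > 0 \<and>
       (\<forall>g\<in>carrier A. (\<forall>p\<in>P0. p (g \<ominus> h) < d) \<longrightarrow> g \<in> U))"
    (is "_ \<longleftrightarrow> ?nbhd U")
proof
  let ?B = "insert (carrier A)
       {{g \<in> carrier A. p (g \<ominus> f) < e} | p f e. p \<in> P \<and> f \<in> carrier A \<and> e > 0}"
  assume "openin (seminorm_topology A P) U"
  then have "generate_topology_on ?B U"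
    by (simp add: seminorm_topology_def openin_topology_generated_by_iff)
  then show "?nbhd U"
  proof induction
    case Empty
    then show ?case by simp
  next
    case (Int a b)
    show ?case
    proof (intro conjI ballI)
      show "a \<inter> b \<subseteq> carrier A" using Int.IH by auto
    next
      fix h assume h: "h \<in> a \<inter> b"
      obtain P1 d1 where 1: "finite P1" "P1 \<subseteq> P" "d1 > 0"
        "\<forall>g\<in>carrier A. (\<forall>p\<in>P1. p (g \<ominus> h) < d1) \<longrightarrow> g \<in> a"
        using Int.IH(1) h by blast
      obtain P2 d2 where 2: "finite P2" "P2 \<subseteq> P" "d2 > 0"
        "\<forall>g\<in>carrier A. (\<forall>p\<in>P2. p (g \<ominus> h) < d2) \<longrightarrow> g \<in> b"
        using Int.IH(2) h by blast
      show "\<exists>P0 d. finite P0 \<and> P0 \<subseteq> P \<and> d > 0 \<and>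
          (\<forall>g\<in>carrier A. (\<forall>p\<in>P0. p (g \<ominus> h) < d) \<longrightarrow> g \<in> a \<inter> b)"
        using 1 2 by (intro exI[of _ "P1 \<union> P2"] exI[of _ "min d1 d2"]) auto
    qed
  next
    case (UN K)
    show ?case
    proof (intro conjI ballI)
      show "\<Union> K \<subseteq> carrier A" using UN.IH by blast
    next
      fix h assume "h \<in> \<Union> K"
      then obtain k where k: "k \<in> K" "h \<in> k" by blast
      obtain P1 d1 where "finite P1" "P1 \<subseteq> P" "d1 > 0"
        "\<forall>g\<in>carrier A. (\<forall>p\<in>P1. p (g \<ominus> h) < d1) \<longrightarrow> g \<in> k"
        using UN.IH[OF k(1)] k(2) by blast
      then show "\<exists>P0 d. finite P0 \<and> P0 \<subseteq> P \<and> d > 0 \<and>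
          (\<forall>g\<in>carrier A. (\<forall>p\<in>P0. p (g \<ominus> h) < d) \<longrightarrow> g \<in> \<Union> K)"
        using k(1) by (intro exI[of _ P1] exI[of _ d1]) blast
    qed
  next
    case (Basis s)
    show ?case
    proof (cases "s = carrier A")
      case True
      then show ?thesis by (auto intro!: exI[of _ "{}"] exI[of _ 1])
    next
      case False
      then obtain p f e where s: "s = {g \<in> carrier A. p (g \<ominus> f) < e}" "p \<in> P" "f \<in> carrier A"
        using Basis by auto
      show ?thesis
      proof (intro conjI ballI)
        show "s \<subseteq> carrier A" using s by auto
      next
        fix h assume h: "h \<in> s"
        have "p (g \<ominus> f) < e" if g: "g \<in> carrier A" "p (g \<ominus> h) < e - p (h \<ominus> f)" for g
        proof -
          have "p (g \<ominus> f) \<le> p (g \<ominus> h) + p (h \<ominus> f)"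
            using minus_split[of g f h] P s h g by (auto simp: subadditive_def)
          then show ?thesis using g by simp
        qed
        then show "\<exists>P0 d. finite P0 \<and> P0 \<subseteq> P \<and> d > 0 \<and>
            (\<forall>g\<in>carrier A. (\<forall>p\<in>P0. p (g \<ominus> h) < d) \<longrightarrow> g \<in> s)"
          using s h by (intro exI[of _ "{p}"] exI[of _ "e - p (h \<ominus> f)"]) auto
      qed
    qed
  qed
next
  assume U: "?nbhd U"
  have open_carrier: "openin (seminorm_topology A P) (carrier A)"
    unfolding seminorm_topology_def by (rule topology_generated_by_Basis) simp
  show "openin (seminorm_topology A P) U"
  proof (subst openin_subopen, intro ballI)
    fix h assume h: "h \<in> U"
    then obtain P0 d where P0: "finite P0" "P0 \<subseteq> P" "d > 0"
      "\<forall>g\<in>carrier A. (\<forall>p\<in>P0. p (g \<ominus> h) < d) \<longrightarrow> g \<in> U"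
      using U by blast
    have hA: "h \<in> carrier A" using U h by blast
    let ?N = "\<Inter> (insert (carrier A) ((\<lambda>p. {g \<in> carrier A. p (g \<ominus> h) < d}) ` P0))"
    have "openin (seminorm_topology A P) {g \<in> carrier A. p (g \<ominus> h) < d}" if "p \<in> P0" for p
      unfolding seminorm_topology_def
      by (rule topology_generated_by_Basis) (use that P0 hA in blast)
    then have "openin (seminorm_topology A P) ?N"
      using P0(1) open_carrier by (intro openin_Inter) auto
    moreover have "h \<ominus> h = \<zero>" using hA by simp
    then have "h \<in> ?N" using P hA P0(2,3) by (fastforce simp: subadditive_def)
    moreover have "?N \<subseteq> U" using P0(4) by auto
    ultimately show "\<exists>T. openin (seminorm_topology A P) T \<and> h \<in> T \<and> T \<subseteq> U" by blast
  qed
qed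

lemma topspace_seminorm_topology: "topspace (seminorm_topology A P) = carrier A"
  by (auto simp: seminorm_topology_def topology_generated_by_topspace)

lemma openin_dominated:
  assumes "subadditive A P" "subadditive A Q" and dom: "dominated A P Q"
    and U: "openin (seminorm_topology A P) U"
  shows "openin (seminorm_topology A Q) U"
  unfolding openin_seminorm_topology[OF assms(2)]
proof (intro conjI ballI)
  show UA: "U \<subseteq> carrier A" using U by (simp add: openin_seminorm_topology[OF assms(1)])
  fix h assume h: "h \<in> U"
  obtain P0 e where P0: "finite P0" "P0 \<subseteq> P" "e > 0"
    "\<forall>g\<in>carrier A. (\<forall>p\<in>P0. p (g \<ominus> h) < e) \<longrightarrow> g \<in> U"
    using U[unfolded openin_seminorm_topology[OF assms(1)]] h by blast
  have "\<forall>p\<in>P0. \<exists>Q0 d. finite Q0 \<and> Q0 \<subseteq> Q \<and> d > 0 \<and>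
     (\<forall>f\<in>carrier A. (\<forall>q\<in>Q0. q f < d) \<longrightarrow> p f < e)"
    using dom P0 unfolding dominated_def by blast
  then obtain Q0 d where Qd: "\<And>p. p \<in> P0 \<Longrightarrow> finite (Q0 p) \<and> Q0 p \<subseteq> Q \<and> d p > 0 \<and>
     (\<forall>f\<in>carrier A. (\<forall>q\<in>Q0 p. q f < d p) \<longrightarrow> p f < e)"
    by metis
  let ?d = "Min (insert (1::real) (d ` P0))"
  have d: "?d > 0" "\<And>p. p \<in> P0 \<Longrightarrow> ?d \<le> d p"
    using P0(1) Qd by auto
  show "\<exists>Q0 d. finite Q0 \<and> Q0 \<subseteq> Q \<and> d > 0 \<and>
      (\<forall>g\<in>carrier A. (\<forall>q\<in>Q0. q (g \<ominus> h) < d) \<longrightarrow> g \<in> U)"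
  proof (intro exI[of _ "\<Union>p\<in>P0. Q0 p"] exI[of _ ?d] conjI ballI impI)
    show "finite (\<Union>p\<in>P0. Q0 p)" "(\<Union>p\<in>P0. Q0 p) \<subseteq> Q" using P0(1) Qd by auto
    show "?d > 0" by (rule d)
    fix g assume g: "g \<in> carrier A" "\<forall>q\<in>\<Union>p\<in>P0. Q0 p. q (g \<ominus> h) < ?d"
    have gh: "g \<ominus> h \<in> carrier A" using g h UA by auto
    have "p (g \<ominus> h) < e" if p: "p \<in> P0" for p
    proof -
      have "\<forall>q\<in>Q0 p. q (g \<ominus> h) < d p" using g(2) d(2)[OF p] p by fastforce
      then show ?thesis using Qd[OF p] gh by blast
    qed
    then show "g \<in> U" using P0(4) g(1) by blast
  qed
qed

lemma seminorm_topology_eqI: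
  assumes "subadditive A P" "subadditive A Q" "dominated A P Q" "dominated A Q P"
  shows "seminorm_topology A P = seminorm_topology A Q"
  unfolding topology_eq
  using openin_dominated[OF assms(1,2,3)] openin_dominated[OF assms(2,1,4)] by blast

lemma limitin_seminorm_topology:
  assumes P: "subadditive A P" and l: "l \<in> carrier A" and F: "F \<le> principal (carrier A)"
    and lim: "\<And>p e. p \<in> P \<Longrightarrow> e > 0 \<Longrightarrow> \<forall>\<^sub>F f in F. p (f \<ominus> l) < e"
  shows "limitin (seminorm_topology A P) (\<lambda>f. f) l F"
  unfolding limitin_def
proof (intro conjI allI impI)
  show "l \<in> topspace (seminorm_topology A P)" using l by (simp add: topspace_seminorm_topology)
  fix U assume U: "openin (seminorm_topology A P) U \<and> l \<in> U"
  then obtain P0 d where P0: "finite P0" "P0 \<subseteq> P" "d > 0"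
    "\<forall>g\<in>carrier A. (\<forall>p\<in>P0. p (g \<ominus> l) < d) \<longrightarrow> g \<in> U"
    using conjunct1[OF U, unfolded openin_seminorm_topology[OF P]] conjunct2[OF U] by blast
  have "\<forall>\<^sub>F f in F. \<forall>p\<in>P0. p (f \<ominus> l) < d"
    using P0 lim by (intro eventually_ball_finite) auto
  moreover have "\<forall>\<^sub>F f in F. f \<in> carrier A"
    using F by (simp add: le_principal)
  ultimately show "\<forall>\<^sub>F f in F. f \<in> U"
    by eventually_elim (use P0(4) in blast)
qed

text \<open>Domination in one direction turns Cauchy filters for \<open>P\<close> into Cauchy filters for \<open>Q\<close>; in both
  directions it identifies the topologies, so a limit for \<open>Q\<close> is a limit for \<open>P\<close>.\<close>
lemma seminorm_complete_transfer:
  assumes "subadditive A P" "subadditive A Q" "dominated A P Q" "dominated A Q P"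
    and Q: "seminorm_complete A Q"
  shows "seminorm_complete A P"
  unfolding seminorm_complete_def
proof (intro allI impI)
  fix F :: "'a filter"
  assume F: "F \<noteq> bot" "F \<le> principal (carrier A)"
    and C: "\<forall>p\<in>P. \<forall>e>0. \<forall>\<^sub>F (f, g) in F \<times>\<^sub>F F. p (f \<ominus> g) < e"
  have "\<forall>\<^sub>F f in F. f \<in> carrier A" using F(2) by (simp add: le_principal)
  then have carr: "\<forall>\<^sub>F (f, g) in F \<times>\<^sub>F F. f \<in> carrier A \<and> g \<in> carrier A"
    unfolding eventually_prod_filter by (intro exI[of _ "\<lambda>f. f \<in> carrier A"]) simp
  have "\<forall>\<^sub>F (f, g) in F \<times>\<^sub>F F. q (f \<ominus> g) < e" if q: "q \<in> Q" "e > 0" for q e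
  proof -
    obtain P0 d where P0: "finite P0" "P0 \<subseteq> P" "d > 0"
      "\<forall>f\<in>carrier A. (\<forall>p\<in>P0. p f < d) \<longrightarrow> q f < e"
      using assms(4)[unfolded dominated_def, rule_format, OF q] by blast
    have "\<forall>\<^sub>F x in F \<times>\<^sub>F F. \<forall>p\<in>P0. p (fst x \<ominus> snd x) < d"
      using P0 C by (intro eventually_ball_finite) (auto simp: case_prod_unfold)
    with carr show ?thesis
      by eventually_elim (use P0(4) in auto)
  qed
  then show "\<exists>l. limitin (seminorm_topology A P) (\<lambda>f. f) l F"
    using Q F unfolding seminorm_complete_def seminorm_topology_eqI[OF assms(1-4)] by blast
qed

text \<open>The balls measure \<open>p (x - h)\<close> with the centre on the right, so splitting \<open>p (f - g)\<close> at a
  common point of two balls uses the symmetry of \<open>p\<close> once.\<close>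
lemma Hausdorff_seminorm_topology:
  assumes P: "subadditive A P"
    and sep: "\<And>f. f \<in> carrier A \<Longrightarrow> f \<noteq> \<zero> \<Longrightarrow> \<exists>p\<in>P. p f > 0 \<and> (\<forall>g\<in>carrier A. p (\<ominus> g) = p g)"
  shows "Hausdorff_space (seminorm_topology A P)"
  unfolding Hausdorff_space_def topspace_seminorm_topology
proof (intro allI impI)
  fix f g assume fg: "f \<in> carrier A \<and> g \<in> carrier A \<and> f \<noteq> g"
  then have "f \<ominus> g \<noteq> \<zero>" by (simp add: minus_eq_zero_iff)
  then obtain p where p: "p \<in> P" "p (f \<ominus> g) > 0" "\<forall>g\<in>carrier A. p (\<ominus> g) = p g"
    using sep[of "f \<ominus> g"] fg by auto
  have p0: "p \<zero> = 0"
    and tri: "\<And>a b. a \<in> carrier A \<Longrightarrow> b \<in> carrier A \<Longrightarrow> p (a \<oplus> b) \<le> p a + p b"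
    using P p(1) by (auto simp: subadditive_def)
  let ?e = "p (f \<ominus> g) / 2"
  let ?N = "\<lambda>h. {x \<in> carrier A. p (x \<ominus> h) < ?e}"
  have "openin (seminorm_topology A P) (?N h)" if "h \<in> carrier A" for h
    unfolding seminorm_topology_def
    by (rule topology_generated_by_Basis) (use that p half_gt_zero[OF p(2)] in blast)
  moreover have "h \<in> ?N h" if "h \<in> carrier A" for h
    using that p(2) by (simp add: p0)
  moreover have "disjnt (?N f) (?N g)"
    unfolding disjnt_iff
  proof (intro allI notI)
    fix x assume x: "x \<in> ?N f \<and> x \<in> ?N g"
    have "f \<ominus> g = (f \<ominus> x) \<oplus> (x \<ominus> g)" using x fg by (intro minus_split) auto
    then have "p (f \<ominus> g) \<le> p (f \<ominus> x) + p (x \<ominus> g)"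
      using tri[of "f \<ominus> x" "x \<ominus> g"] x fg by simp
    moreover have "f \<ominus> x = \<ominus> (x \<ominus> f)"
      using x fg by (simp add: alg_simps(10,14,19,20))
    then have "p (f \<ominus> x) = p (x \<ominus> f)" using p(3) x fg by auto
    ultimately show False using x by auto
  qed
  ultimately show "\<exists>U V. openin (seminorm_topology A P) U \<and> openin (seminorm_topology A P) V \<and>
      f \<in> U \<and> g \<in> V \<and> disjnt U V"
    using fg by (intro exI[of _ "?N f"] exI[of _ "?N g"] conjI) auto
qed

section \<open>Positive forms\<close>

lemma form_add:
  assumes "\<phi> \<in> linear_forms A" "f \<in> carrier A" "g \<in> carrier A"
  shows "\<phi> (f \<oplus> g) = \<phi> f + \<phi> g"
  using assms by (simp add: linear_forms_def)

lemma form_smult: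
  assumes "\<phi> \<in> linear_forms A" "f \<in> carrier A"
  shows "\<phi> (c \<odot> f) = c * \<phi> f"
  using assms by (simp add: linear_forms_def)

lemma smult_carrier [simp]: "f \<in> carrier A \<Longrightarrow> c \<odot> f \<in> carrier A"
  using smult_closed[of c f] by (simp add: complex_ring_def)

lemma smult_add:
  "f \<in> carrier A \<Longrightarrow> g \<in> carrier A \<Longrightarrow> c \<odot> (f \<oplus> g) = c \<odot> f \<oplus> c \<odot> g"
  using smult_r_distr[of c f g] by (simp add: complex_ring_def)

text \<open>For real \<open>t\<close> the number \<open>\<phi> ((f + t g)\<^sup>* (f + t g))\<close> is a nonnegative quadratic
  polynomial in \<open>t\<close>. Its discriminant bounds the mixed term \<open>B\<close>, which is the Cauchy-Schwarz
  inequality, and the case \<open>t = 1\<close> is the triangle inequality.\<close>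
lemma form_seminorm_triangle:
  assumes \<phi>: "\<phi> \<in> positive_forms A" and f: "f \<in> carrier A" and g: "g \<in> carrier A"
  shows "form_seminorm A \<phi> (f \<oplus> g) \<le> form_seminorm A \<phi> f + form_seminorm A \<phi> g"
proof -
  have lin: "\<phi> \<in> linear_forms A" using \<phi> by (simp add: positive_forms_def)
  define N where "N h = Re (\<phi> (star h \<otimes> h))" for h
  define B where "B = Re (\<phi> (star f \<otimes> g)) + Re (\<phi> (star g \<otimes> f))"
  have N0: "N h \<ge> 0" if "h \<in> carrier A" for h
    using \<phi> that by (auto simp: N_def positive_forms_def nonneg_Reals_def)
  have expand: "N (f \<oplus> complex_of_real t \<odot> g) = N f + t * B + t^2 * N g" for t
  proof -
    let ?t = "complex_of_real t"
    have s: "star (f \<oplus> ?t \<odot> g) = star f \<oplus> ?t \<odot> star g"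
      using f g by (simp add: star_add star_smult)
    have "star (f \<oplus> ?t \<odot> g) \<otimes> (f \<oplus> ?t \<odot> g) =
       (star f \<otimes> f \<oplus> ?t \<odot> (star g \<otimes> f)) \<oplus> (?t \<odot> (star f \<otimes> g) \<oplus> ?t \<odot> (?t \<odot> (star g \<otimes> g)))"
      unfolding s using f g
      by (simp add: alg_simps(13,23) smult_mult_left smult_mult_right star_closed smult_add)
    then show ?thesis
      unfolding N_def B_def using f g
      by (simp add: form_add[OF lin] form_smult[OF lin] star_closed algebra_simps power2_eq_square)
  qed
  have quad: "0 \<le> N f + t * B + t^2 * N g" for t
    using N0[of "f \<oplus> complex_of_real t \<odot> g"] f g by (simp add: expand)
  have "B\<^sup>2 \<le> 4 * N f * N g"
  proof (cases "N g = 0")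
    case True
    have "B = 0"
    proof (rule ccontr)
      assume "B \<noteq> 0"
      \<comment> \<open>at this parameter the affine function \<open>t \<mapsto> N f + t B\<close> has the value \<open>- 1\<close>\<close>
      then show False using quad[of "- (N f + 1) / B"] True by simp
    qed
    then show ?thesis using True by simp
  next
    case False
    then have "N g > 0" using N0[OF g] by simp
    then show ?thesis
      using quad[of "- B / (2 * N g)"] by (simp add: field_simps power2_eq_square)
  qed
  then have "\<bar>B\<bar> \<le> sqrt (4 * N f * N g)"
    by (metis real_sqrt_abs real_sqrt_le_iff)
  then have B: "B \<le> 2 * (sqrt (N f) * sqrt (N g))"
    by (simp add: real_sqrt_mult)
  have "\<one>\<^bsub>complex_ring\<^esub> \<odot> g = g" using g by (rule smult_one)
  then have "N (f \<oplus> g) = N f + B + N g"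
    using expand[of 1] by (simp add: complex_ring_def)
  also have "\<dots> \<le> (sqrt (N f) + sqrt (N g))\<^sup>2"
    using B N0[OF f] N0[OF g] by (simp add: power2_sum)
  finally have "sqrt (N (f \<oplus> g)) \<le> sqrt (N f) + sqrt (N g)"
    using N0[OF f] N0[OF g] by (intro real_le_lsqrt) auto
  then show ?thesis by (simp add: form_seminorm_def N_def)
qed

end


section \<open>Rapidly decreasing coefficients\<close>

definition weight :: "int \<times> int \<Rightarrow> real" where
  "weight x = 1 + \<bar>real_of_int (fst x)\<bar> + \<bar>real_of_int (snd x)\<bar>"

definition schwartz :: "(int \<times> int \<Rightarrow> complex) set" where
  "schwartz = {f. \<forall>m. bdd_above (range (torus_weighted m f))}"

text \<open>The factor by which \<open>U\<^sup>k V\<^sup>l U\<^sup>a V\<^sup>b\<close> differs from \<open>U\<^sup>k\<^sup>+\<^sup>a V\<^sup>l\<^sup>+\<^sup>b\<close>. It is a bicharacter of the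
  index group, and on the diagonal it gives the factor of the involution.\<close>
definition cocycle :: "complex \<Rightarrow> int \<times> int \<Rightarrow> int \<times> int \<Rightarrow> complex" where
  "cocycle q x y = q powi (- snd x * fst y)"

definition twisted_conv ::
  "complex \<Rightarrow> (int \<times> int \<Rightarrow> complex) \<Rightarrow> (int \<times> int \<Rightarrow> complex) \<Rightarrow> int \<times> int \<Rightarrow> complex" where
  "twisted_conv q f g x = (\<Sum>\<^sub>\<infinity>y\<in>UNIV. f y * g (x - y) * cocycle q y (x - y))"

lemma torus_weighted_eq: "torus_weighted m f x = cmod (f x) * weight x ^ m"
  by (simp add: torus_weighted_def weight_def case_prod_unfold)

lemma weight_ge_1: "weight x \<ge> 1"
  by (simp add: weight_def)

lemma weight_pos [simp]: "weight x > 0" "weight x \<ge> 0" "weight x \<noteq> 0"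
  using weight_ge_1[of x] by linarith+

lemma weight_uminus [simp]: "weight (- x) = weight x"
  by (simp add: weight_def)

text \<open>Submultiplicativity of the weight is what makes the weighted norms compatible with convolution.\<close>
lemma weight_add: "weight (x + y) \<le> weight x * weight y"
proof -
  have "\<bar>real_of_int (fst x)\<bar> + \<bar>real_of_int (snd x)\<bar> \<ge> 0"
    "\<bar>real_of_int (fst y)\<bar> + \<bar>real_of_int (snd y)\<bar> \<ge> 0" by simp_all
  then have "(\<bar>real_of_int (fst x)\<bar> + \<bar>real_of_int (snd x)\<bar>) *
     (\<bar>real_of_int (fst y)\<bar> + \<bar>real_of_int (snd y)\<bar>) \<ge> 0" by (rule mult_nonneg_nonneg)
  moreover have "weight x * weight y = (1 + (\<bar>real_of_int (fst x)\<bar> + \<bar>real_of_int (snd x)\<bar>)) *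
     (1 + (\<bar>real_of_int (fst y)\<bar> + \<bar>real_of_int (snd y)\<bar>))"
    by (simp add: weight_def add.assoc)
  moreover have "\<bar>real_of_int (fst x) + real_of_int (fst y)\<bar> \<le>
      \<bar>real_of_int (fst x)\<bar> + \<bar>real_of_int (fst y)\<bar>"
    "\<bar>real_of_int (snd x) + real_of_int (snd y)\<bar> \<le>
      \<bar>real_of_int (snd x)\<bar> + \<bar>real_of_int (snd y)\<bar>"
    by (rule abs_triangle_ineq)+
  ultimately show ?thesis
    unfolding weight_def fst_add snd_add of_int_add by (simp only: distrib_left distrib_right)
qed

lemma schwartzI:
  assumes "\<And>m. \<exists>C. \<forall>x. cmod (f x) * weight x ^ m \<le> C"
  shows "f \<in> schwartz"
  using assms by (force simp: schwartz_def bdd_above_def torus_weighted_eq)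

lemma torus_norm_upper:
  assumes "f \<in> schwartz"
  shows "cmod (f x) * weight x ^ m \<le> torus_norm m f"
proof -
  have "torus_weighted m f x \<le> torus_norm m f"
    unfolding torus_norm_def by (rule cSUP_upper) (use assms in \<open>simp_all add: schwartz_def\<close>)
  then show ?thesis by (simp add: torus_weighted_eq)
qed

lemma torus_norm_least:
  assumes "\<And>x. cmod (f x) * weight x ^ m \<le> C"
  shows "torus_norm m f \<le> C"
  unfolding torus_norm_def by (rule cSUP_least) (simp_all add: torus_weighted_eq assms)

lemma torus_norm_nonneg: "f \<in> schwartz \<Longrightarrow> torus_norm m f \<ge> 0"
  using torus_norm_upper[of f 0 m] by (smt (verit) mult_nonneg_nonneg norm_ge_zero weight_pos zero_le_power)

lemma torus_norm_mono:
  assumes "f \<in> schwartz" "m \<le> n"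
  shows "torus_norm m f \<le> torus_norm n f"
proof (rule torus_norm_least)
  fix x
  have "cmod (f x) * weight x ^ m \<le> cmod (f x) * weight x ^ n"
    by (intro mult_left_mono power_increasing assms weight_ge_1) simp
  also have "\<dots> \<le> torus_norm n f" by (rule torus_norm_upper[OF assms(1)])
  finally show "cmod (f x) * weight x ^ m \<le> torus_norm n f" .
qed

lemma abs_summable_times:
  fixes f :: "'a \<Rightarrow> 'c::{real_normed_div_algebra}" and g :: "'b \<Rightarrow> 'c"
  assumes "(\<lambda>x. norm (f x)) summable_on A" "(\<lambda>x. norm (g x)) summable_on B"
  shows "(\<lambda>(x, y). norm (f x * g y)) summable_on A \<times> B"
proof -
  have "\<forall>x\<in>A. (\<lambda>y. norm (case (x, y) of (x, y) \<Rightarrow> f x * g y)) summable_on B"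
    using assms(2) by (simp add: norm_mult summable_on_cmult_right)
  moreover have "(\<lambda>x. norm (\<Sum>\<^sub>\<infinity>y\<in>B. norm (case (x, y) of (x, y) \<Rightarrow> f x * g y))) summable_on A"
    using summable_on_cmult_left[OF assms(1), of "\<Sum>\<^sub>\<infinity>y\<in>B. norm (g y)"]
    by (simp add: norm_mult infsum_cmult_right' infsum_nonneg)
  ultimately have "(\<lambda>p. norm (case p of (x, y) \<Rightarrow> f x * g y)) summable_on A \<times> B"
    unfolding Infinite_Sum.abs_summable_on_Sigma_iff by blast
  then show ?thesis by (simp add: case_prod_unfold)
qed

lemma summable_on_inverse_square_int:
  "(\<lambda>k::int. 1 / (1 + \<bar>real_of_int k\<bar>)\<^sup>2) summable_on UNIV"
proof -
  let ?f = "\<lambda>k::int. 1 / (1 + \<bar>real_of_int k\<bar>)\<^sup>2"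
  have "summable (\<lambda>n. inverse (real (Suc n) ^ 2))"
    using inverse_power_summable[of 2, where 'a = real] by (subst summable_Suc_iff) simp
  then have nat: "(\<lambda>n::nat. 1 / (1 + real n)\<^sup>2) summable_on UNIV"
    by (subst summable_on_UNIV_nonneg_real_iff) (simp_all add: field_simps)
  have "?f summable_on range int"
    by (subst summable_on_reindex) (use nat in \<open>simp_all add: o_def inj_on_def\<close>)
  moreover have "?f summable_on range (\<lambda>n. - int n)"
    by (subst summable_on_reindex) (use nat in \<open>simp_all add: o_def inj_on_def\<close>)
  ultimately have "?f summable_on (range int \<union> range (\<lambda>n. - int n))"
    by (rule summable_on_union)
  moreover have "UNIV = range int \<union> range (\<lambda>n. - int n)"
  proof (rule UNIV_eq_I)
    fix k :: int
    show "k \<in> range int \<union> range (\<lambda>n. - int n)"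
      by (cases k rule: int_cases2) auto
  qed
  ultimately show ?thesis by simp
qed

text \<open>Four powers of the weight dominate \<open>(1 + \<bar>k\<bar>)\<^sup>2 (1 + \<bar>l\<bar>)\<^sup>2\<close>, which reduces the claim to
  a product of two convergent one-dimensional series. This is the source of the shift by \<open>4\<close> in all
  estimates that pass from suprema to sums.\<close>
lemma summable_on_weight: "(\<lambda>x. 1 / weight x ^ 4) summable_on UNIV"
proof -
  let ?a = "\<lambda>k::int. 1 / (1 + \<bar>real_of_int k\<bar>)\<^sup>2"
  have "(\<lambda>(k, l). norm (?a k * ?a l)) summable_on UNIV \<times> UNIV"
    using summable_on_inverse_square_int by (intro abs_summable_times) auto
  then have "(\<lambda>x. ?a (fst x) * ?a (snd x)) summable_on UNIV"
    by (simp add: case_prod_unfold)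
  then show ?thesis
  proof (rule summable_on_comparison_test)
    fix x :: "int \<times> int"
    have "((1 + \<bar>real_of_int (fst x)\<bar>) * (1 + \<bar>real_of_int (snd x)\<bar>))\<^sup>2 \<le> (weight x * weight x)\<^sup>2"
      by (intro power_mono mult_mono) (auto simp: weight_def)
    then have le: "(1 + \<bar>real_of_int (fst x)\<bar>)\<^sup>2 * (1 + \<bar>real_of_int (snd x)\<bar>)\<^sup>2 \<le> weight x ^ 4"
      by (simp add: power_mult_distrib flip: power_add)
    have "0 < (1 + \<bar>real_of_int (fst x)\<bar>)\<^sup>2 * (1 + \<bar>real_of_int (snd x)\<bar>)\<^sup>2"
      by (intro mult_pos_pos zero_less_power) auto
    then show "1 / weight x ^ 4 \<le> ?a (fst x) * ?a (snd x)"
      using frac_le[of 1 1, OF _ _ _ le] by simp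
  qed simp
qed

definition weight_mass :: real where
  "weight_mass = (\<Sum>\<^sub>\<infinity>x\<in>UNIV. 1 / weight x ^ 4)"

lemma weight_mass_nonneg: "weight_mass \<ge> 0"
  unfolding weight_mass_def by (rule infsum_nonneg) simp

lemma schwartz_decay:
  assumes "f \<in> schwartz"
  shows "cmod (f x) * weight x ^ m \<le> torus_norm (m + 4) f * (1 / weight x ^ 4)"
  using torus_norm_upper[OF assms, of x "m + 4"] by (simp add: field_simps power_add)

lemma schwartz_summable:
  assumes "f \<in> schwartz"
  shows "(\<lambda>x. cmod (f x) * weight x ^ m) summable_on UNIV"
    and "(\<Sum>\<^sub>\<infinity>x\<in>UNIV. cmod (f x) * weight x ^ m) \<le> torus_norm (m + 4) f * weight_mass"
proof -
  have s: "(\<lambda>x. torus_norm (m + 4) f * (1 / weight x ^ 4)) summable_on UNIV"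
    using summable_on_weight by (rule summable_on_cmult_right)
  show 1: "(\<lambda>x. cmod (f x) * weight x ^ m) summable_on UNIV"
    by (rule summable_on_comparison_test[OF s]) (use schwartz_decay[OF assms] in auto)
  show "(\<Sum>\<^sub>\<infinity>x\<in>UNIV. cmod (f x) * weight x ^ m) \<le> torus_norm (m + 4) f * weight_mass"
    unfolding weight_mass_def infsum_cmult_right'[symmetric]
    by (rule infsum_mono[OF 1 s]) (rule schwartz_decay[OF assms])
qed

lemma schwartz_abs_summable: "f \<in> schwartz \<Longrightarrow> (\<lambda>x. cmod (f x)) summable_on UNIV"
  using schwartz_summable(1)[of f 0] by simp

lemma schwartz_bound: "f \<in> schwartz \<Longrightarrow> cmod (f x) \<le> torus_norm 0 f"
  using torus_norm_upper[of f x 0] by simp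

lemma schwartz_add:
  assumes "f \<in> schwartz" "g \<in> schwartz"
  shows "(\<lambda>x. f x + g x) \<in> schwartz"
    and "torus_norm m (\<lambda>x. f x + g x) \<le> torus_norm m f + torus_norm m g"
proof -
  have le: "cmod (f x + g x) * weight x ^ m \<le> torus_norm m f + torus_norm m g" for x m
  proof -
    have "cmod (f x + g x) * weight x ^ m \<le> (cmod (f x) + cmod (g x)) * weight x ^ m"
      by (intro mult_right_mono norm_triangle_ineq) simp
    then show ?thesis
      using torus_norm_upper[OF assms(1), of x m] torus_norm_upper[OF assms(2), of x m]
      by (simp add: distrib_right)
  qed
  show "(\<lambda>x. f x + g x) \<in> schwartz" using le by (intro schwartzI) blast
  show "torus_norm m (\<lambda>x. f x + g x) \<le> torus_norm m f + torus_norm m g"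
    by (rule torus_norm_least) (rule le)
qed

lemma schwartz_cmult:
  assumes "f \<in> schwartz"
  shows "(\<lambda>x. c * f x) \<in> schwartz"
    and "torus_norm m (\<lambda>x. c * f x) \<le> cmod c * torus_norm m f"
proof -
  have le: "cmod (c * f x) * weight x ^ m \<le> cmod c * torus_norm m f" for x m
    using mult_left_mono[OF torus_norm_upper[OF assms, of x m], of "cmod c"]
    by (simp add: norm_mult mult.assoc)
  show "(\<lambda>x. c * f x) \<in> schwartz" using le by (intro schwartzI) blast
  show "torus_norm m (\<lambda>x. c * f x) \<le> cmod c * torus_norm m f"
    by (rule torus_norm_least) (rule le)
qed

lemma schwartz_finite_support: "finite {x. f x \<noteq> 0} \<Longrightarrow> f \<in> schwartz"
proof (rule schwartzI, rule exI, intro allI)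
  fix m x assume fin: "finite {x. f x \<noteq> 0}"
  show "cmod (f x) * weight x ^ m \<le> (\<Sum>x | f x \<noteq> 0. cmod (f x) * weight x ^ m)"
  proof (cases "f x = 0")
    case True
    then show ?thesis by (auto intro!: sum_nonneg)
  next
    case False
    then show ?thesis using fin by (intro member_le_sum) auto
  qed
qed

section \<open>The twisted convolution\<close>

locale unitary_parameter =
  fixes q :: complex
  assumes q: "cmod q = 1"
begin

lemma q_nonzero [simp]: "q \<noteq> 0"
  using q by auto

lemma norm_powi [simp]: "cmod (q powi n) = 1"
  using q by (simp add: norm_power_int)

lemma norm_cocycle [simp]: "cmod (cocycle q x y) = 1"
  by (simp add: cocycle_def)

lemma cnj_powi [simp]: "cnj q powi n = q powi (- n)"
proof -
  have "q * cnj q = 1"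
    using q by (simp add: complex_norm_square[symmetric])
  then have "cnj q = inverse q" by (simp add: field_simps)
  then show ?thesis by (simp add: power_int_inverse power_int_minus)
qed

lemma conv_term_summable:
  assumes "f \<in> schwartz" "g \<in> schwartz"
  shows "(\<lambda>y. cmod (f y * g (x - y) * cocycle q y (x - y))) summable_on UNIV"
proof (rule summable_on_comparison_test)
  show "(\<lambda>y. cmod (f y) * torus_norm 0 g) summable_on UNIV"
    by (rule summable_on_cmult_left[OF schwartz_abs_summable[OF assms(1)]])
  show "cmod (f y * g (x - y) * cocycle q y (x - y)) \<le> cmod (f y) * torus_norm 0 g" for y
    using schwartz_bound[OF assms(2)] by (simp add: norm_mult mult_left_mono)
qed simp

text \<open>Distribute the weight over the two factors by submultiplicativity, bound the second factor by its
  supremum and sum the first one.\<close>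
lemma conv_bound:
  assumes f: "f \<in> schwartz" and g: "g \<in> schwartz"
  shows "cmod (twisted_conv q f g x) * weight x ^ m \<le> weight_mass * torus_norm (m + 4) f * torus_norm m g"
proof -
  have "cmod (twisted_conv q f g x) \<le> (\<Sum>\<^sub>\<infinity>y\<in>UNIV. cmod (f y * g (x - y) * cocycle q y (x - y)))"
    unfolding twisted_conv_def by (rule norm_infsum_bound[OF conv_term_summable[OF f g]])
  then have "cmod (twisted_conv q f g x) * weight x ^ m \<le>
      (\<Sum>\<^sub>\<infinity>y\<in>UNIV. cmod (f y * g (x - y) * cocycle q y (x - y))) * weight x ^ m"
    by (rule mult_right_mono) simp
  also have "\<dots> = (\<Sum>\<^sub>\<infinity>y\<in>UNIV. cmod (f y * g (x - y) * cocycle q y (x - y)) * weight x ^ m)"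
    by (rule infsum_cmult_left'[symmetric])
  also have "\<dots> \<le> (\<Sum>\<^sub>\<infinity>y\<in>UNIV. cmod (f y) * weight y ^ m * torus_norm m g)"
  proof (rule infsum_mono)
    show "(\<lambda>y. cmod (f y * g (x - y) * cocycle q y (x - y)) * weight x ^ m) summable_on UNIV"
      by (rule summable_on_cmult_left[OF conv_term_summable[OF f g]])
    show "(\<lambda>y. cmod (f y) * weight y ^ m * torus_norm m g) summable_on UNIV"
      by (rule summable_on_cmult_left[OF schwartz_summable(1)[OF f]])
    fix y
    have "weight x ^ m \<le> (weight y * weight (x - y)) ^ m"
      using weight_add[of y "x - y"] by (intro power_mono) auto
    then have "cmod (f y) * cmod (g (x - y)) * weight x ^ m \<le>
        cmod (f y) * cmod (g (x - y)) * (weight y ^ m * weight (x - y) ^ m)"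
      by (intro mult_left_mono) (auto simp: power_mult_distrib)
    also have "\<dots> = cmod (f y) * weight y ^ m * (cmod (g (x - y)) * weight (x - y) ^ m)"
      by simp
    also have "\<dots> \<le> cmod (f y) * weight y ^ m * torus_norm m g"
      by (intro mult_left_mono torus_norm_upper[OF g]) simp
    finally show "cmod (f y * g (x - y) * cocycle q y (x - y)) * weight x ^ m \<le>
        cmod (f y) * weight y ^ m * torus_norm m g"
      by (simp add: norm_mult)
  qed
  also have "\<dots> = (\<Sum>\<^sub>\<infinity>y\<in>UNIV. cmod (f y) * weight y ^ m) * torus_norm m g"
    by (rule infsum_cmult_left')
  also have "\<dots> \<le> torus_norm (m + 4) f * weight_mass * torus_norm m g"
    by (intro mult_right_mono schwartz_summable(2) f torus_norm_nonneg[OF g])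
  finally show ?thesis by (simp add: mult_ac)
qed

lemma conv_closed:
  assumes "f \<in> schwartz" "g \<in> schwartz"
  shows "twisted_conv q f g \<in> schwartz"
  using conv_bound[OF assms] by (intro schwartzI) blast

lemma conv_norm:
  assumes "f \<in> schwartz" "g \<in> schwartz"
  shows "torus_norm m (twisted_conv q f g) \<le> weight_mass * torus_norm (m + 4) f * torus_norm m g"
  by (rule torus_norm_least) (rule conv_bound[OF assms])

lemma conv_add_left:
  assumes "f \<in> schwartz" "g \<in> schwartz" "h \<in> schwartz"
  shows "twisted_conv q (\<lambda>x. f x + g x) h = (\<lambda>x. twisted_conv q f h x + twisted_conv q g h x)"
proof
  fix x
  show "twisted_conv q (\<lambda>x. f x + g x) h x = twisted_conv q f h x + twisted_conv q g h x"
    unfolding twisted_conv_def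
    using infsum_add[OF abs_summable_summable[OF conv_term_summable[OF assms(1,3), of x]]
        abs_summable_summable[OF conv_term_summable[OF assms(2,3), of x]]]
    by (simp add: algebra_simps)
qed

lemma conv_add_right:
  assumes "f \<in> schwartz" "g \<in> schwartz" "h \<in> schwartz"
  shows "twisted_conv q f (\<lambda>x. g x + h x) = (\<lambda>x. twisted_conv q f g x + twisted_conv q f h x)"
proof
  fix x
  show "twisted_conv q f (\<lambda>x. g x + h x) x = twisted_conv q f g x + twisted_conv q f h x"
    unfolding twisted_conv_def
    using infsum_add[OF abs_summable_summable[OF conv_term_summable[OF assms(1,2), of x]]
        abs_summable_summable[OF conv_term_summable[OF assms(1,3), of x]]]
    by (simp add: algebra_simps)
qed

lemma conv_cmult_left: "twisted_conv q (\<lambda>x. c * f x) g = (\<lambda>x. c * twisted_conv q f g x)"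
  by (simp add: twisted_conv_def fun_eq_iff mult.assoc infsum_cmult_right')

lemma conv_cmult_right: "twisted_conv q f (\<lambda>x. c * g x) = (\<lambda>x. c * twisted_conv q f g x)"
  by (simp add: twisted_conv_def fun_eq_iff mult.assoc mult.left_commute[of _ c] infsum_cmult_right')

lemma conv_one_left: "twisted_conv q (\<lambda>x. if x = 0 then 1 else 0) f = f"
proof
  fix x
  have "twisted_conv q (\<lambda>x. if x = 0 then 1 else 0) f x = (\<Sum>\<^sub>\<infinity>y\<in>{0 :: int \<times> int}. f x)"
    unfolding twisted_conv_def
    by (rule infsum_cong_neutral) (auto simp: cocycle_def)
  then show "twisted_conv q (\<lambda>x. if x = 0 then 1 else 0) f x = f x" by simp
qed

lemma conv_one_right: "twisted_conv q f (\<lambda>x. if x = 0 then 1 else 0) = f"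
proof
  fix x
  have "twisted_conv q f (\<lambda>x. if x = 0 then 1 else 0) x = (\<Sum>\<^sub>\<infinity>y\<in>{x}. f x)"
    unfolding twisted_conv_def
    by (rule infsum_cong_neutral) (auto simp: cocycle_def)
  then show "twisted_conv q f (\<lambda>x. if x = 0 then 1 else 0) x = f x" by simp
qed

text \<open>This 2-cocycle identity is exactly what associativity of the twisted convolution requires.\<close>
lemma cocycle_identity:
  "cocycle q y w * cocycle q (y + w) z = cocycle q w z * cocycle q y (w + z)"
  by (simp add: cocycle_def power_int_add[symmetric] algebra_simps)

text \<open>Both sides are iterated sums of one absolutely summable double series: the shear
  \<open>(y, w) \<mapsto> (y + w, y)\<close> carries the tensor product of \<open>f\<close> and \<open>g\<close> to the terms of the left side, and
  \<open>h\<close> contributes only a bounded factor.\<close>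
lemma conv_assoc:
  assumes f: "f \<in> schwartz" and g: "g \<in> schwartz" and h: "h \<in> schwartz"
  shows "twisted_conv q (twisted_conv q f g) h = twisted_conv q f (twisted_conv q g h)"
proof
  fix x
  define F where "F z y = f y * g (z - y) * cocycle q y (z - y) * (h (x - z) * cocycle q z (x - z))"
    for z y
  have "(\<lambda>(y, w). cmod (f y * g w)) summable_on UNIV \<times> UNIV"
    by (intro abs_summable_times schwartz_abs_summable f g)
  then have "(\<lambda>p. cmod (f (fst p) * g (snd p))) summable_on UNIV"
    by (simp add: case_prod_unfold)
  then have "(\<lambda>p. cmod (f (snd p) * g (fst p - snd p))) summable_on UNIV"
    by (subst summable_on_reindex_bij_witness[where i = "\<lambda>(y, w). (y + w, y)"
          and j = "\<lambda>(z, y). (y, z - y)" and T = UNIV and h = "\<lambda>p. cmod (f (fst p) * g (snd p))"])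
      auto
  then have s: "(\<lambda>p. cmod (f (snd p) * g (fst p - snd p)) * torus_norm 0 h) summable_on UNIV"
    by (rule summable_on_cmult_left)
  have "(\<lambda>p. cmod (F (fst p) (snd p))) summable_on UNIV"
  proof (rule summable_on_comparison_test[OF s])
    fix p
    show "cmod (F (fst p) (snd p)) \<le> cmod (f (snd p) * g (fst p - snd p)) * torus_norm 0 h"
      using schwartz_bound[OF h] by (simp add: F_def norm_mult mult_left_mono)
  qed simp
  then have F: "(\<lambda>(z, y). F z y) summable_on UNIV \<times> UNIV"
    using abs_summable_summable by (simp add: case_prod_unfold)
  have "twisted_conv q (twisted_conv q f g) h x = (\<Sum>\<^sub>\<infinity>z\<in>UNIV. \<Sum>\<^sub>\<infinity>y\<in>UNIV. F z y)"
    unfolding F_def infsum_cmult_left' by (simp add: twisted_conv_def mult.assoc)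
  also have "\<dots> = (\<Sum>\<^sub>\<infinity>y\<in>UNIV. \<Sum>\<^sub>\<infinity>z\<in>UNIV. F z y)"
    by (rule infsum_swap_banach[OF F])
  also have "\<dots> = (\<Sum>\<^sub>\<infinity>y\<in>UNIV. \<Sum>\<^sub>\<infinity>w\<in>UNIV. F (y + w) y)"
  proof (rule infsum_cong)
    fix y
    show "(\<Sum>\<^sub>\<infinity>z\<in>UNIV. F z y) = (\<Sum>\<^sub>\<infinity>w\<in>UNIV. F (y + w) y)"
      by (rule infsum_reindex_bij_witness[where i = "\<lambda>w. y + w" and j = "\<lambda>z. z - y"]) simp_all
  qed
  also have "\<dots> = (\<Sum>\<^sub>\<infinity>y\<in>UNIV. \<Sum>\<^sub>\<infinity>w\<in>UNIV.
      f y * cocycle q y (x - y) * (g w * h (x - y - w) * cocycle q w (x - y - w)))"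
  proof (intro infsum_cong)
    fix y w :: "int \<times> int"
    have "cocycle q y w * cocycle q (y + w) (x - y - w) = cocycle q w (x - y - w) * cocycle q y (x - y)"
      using cocycle_identity[of y w "x - y - w"] by simp
    moreover have "F (y + w) y =
        f y * g w * h (x - y - w) * (cocycle q y w * cocycle q (y + w) (x - y - w))"
      by (simp add: F_def diff_diff_eq)
    ultimately show "F (y + w) y =
        f y * cocycle q y (x - y) * (g w * h (x - y - w) * cocycle q w (x - y - w))"
      by simp
  qed
  also have "\<dots> = twisted_conv q f (twisted_conv q g h) x"
    unfolding infsum_cmult_right' by (simp add: twisted_conv_def mult_ac)
  finally show "twisted_conv q (twisted_conv q f g) h x = twisted_conv q f (twisted_conv q g h) x" .
qed

definition conv_star :: "(int \<times> int \<Rightarrow> complex) \<Rightarrow> int \<times> int \<Rightarrow> complex" where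
  "conv_star f x = cnj (f (- x)) * cocycle q x x"

lemma conv_star_bound:
  assumes "f \<in> schwartz"
  shows "cmod (conv_star f x) * weight x ^ m \<le> torus_norm m f"
  using torus_norm_upper[OF assms, of "- x" m] by (simp add: conv_star_def norm_mult)

lemma conv_star_closed: "f \<in> schwartz \<Longrightarrow> conv_star f \<in> schwartz"
  using conv_star_bound by (intro schwartzI) blast

lemma conv_star_norm: "f \<in> schwartz \<Longrightarrow> torus_norm m (conv_star f) \<le> torus_norm m f"
  using conv_star_bound by (intro torus_norm_least) blast

lemma conv_star_involution: "conv_star (conv_star f) = f"
  by (simp add: conv_star_def fun_eq_iff cocycle_def flip: power_int_add)

text \<open>The substitution \<open>z = x + y\<close> matches the two sums term by term; what remains is an identity
  between exponents of \<open>q\<close>.\<close>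
lemma conv_star_conv: "conv_star (twisted_conv q f g) = twisted_conv q (conv_star g) (conv_star f)"
proof
  fix x
  have "conv_star (twisted_conv q f g) x =
      (\<Sum>\<^sub>\<infinity>y\<in>UNIV. cnj (f y * g (- x - y) * cocycle q y (- x - y)) * cocycle q x x)"
    by (simp add: conv_star_def twisted_conv_def infsum_cmult_left' del: complex_cnj_mult)
  also have "\<dots> = (\<Sum>\<^sub>\<infinity>z\<in>UNIV. conv_star g z * conv_star f (x - z) * cocycle q z (x - z))"
  proof (rule infsum_reindex_bij_witness[where i = "\<lambda>z. z - x" and j = "\<lambda>y. x + y"])
    fix y :: "int \<times> int"
    have "cnj (cocycle q y (- x - y)) * cocycle q x x =
        cocycle q (x + y) (x + y) * cocycle q (- y) (- y) * cocycle q (x + y) (- y)"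
      by (simp add: cocycle_def power_int_add[symmetric] algebra_simps)
    moreover have "- (x + y) = - x - y" "x - (x + y) = - y" by auto
    ultimately show "conv_star g (x + y) * conv_star f (x - (x + y)) * cocycle q (x + y) (x - (x + y)) =
        cnj (f y * g (- x - y) * cocycle q y (- x - y)) * cocycle q x x"
      by (simp add: conv_star_def mult_ac)
  qed auto
  finally show "conv_star (twisted_conv q f g) x = twisted_conv q (conv_star g) (conv_star f) x"
    by (simp add: twisted_conv_def)
qed


section \<open>The torus as a star-algebra\<close>

text \<open>Indices are treated as elements of an additive group throughout; splitting them into
  coordinates would hide the group operations.\<close>
declare split_paired_All [simp del] split_paired_Ex [simp del]

lemma schwartz_zero [simp]: "(\<lambda>_. 0) \<in> schwartz"
  by (rule schwartz_finite_support) simp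

lemma schwartz_one [simp]: "(\<lambda>x. if x = 0 then 1 else 0) \<in> schwartz"
  by (rule schwartz_finite_support) simp

lemma nc_torus_simps [simp]:
  "carrier (nc_torus q) = schwartz"
  "f \<otimes>\<^bsub>nc_torus q\<^esub> g = twisted_conv q f g"
  "\<one>\<^bsub>nc_torus q\<^esub> = (\<lambda>x. if x = 0 then 1 else 0)"
  "\<zero>\<^bsub>nc_torus q\<^esub> = (\<lambda>_. 0)"
  "f \<oplus>\<^bsub>nc_torus q\<^esub> g = (\<lambda>x. f x + g x)"
  "c \<odot>\<^bsub>nc_torus q\<^esub> f = (\<lambda>x. c * f x)"
  "star\<^bsub>nc_torus q\<^esub> f = conv_star f"
  by (auto simp: nc_torus_def schwartz_def twisted_conv_def conv_star_def cocycle_def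
      fun_eq_iff zero_prod_def minus_prod_def case_prod_unfold mult_ac)

lemma schwartz_uminus: "f \<in> schwartz \<Longrightarrow> (\<lambda>x. - f x) \<in> schwartz"
  using schwartz_cmult(1)[of f "-1"] by simp

lemma abelian_group_nc_torus: "abelian_group (nc_torus q)"
proof (rule abelian_groupI)
  show "\<exists>g\<in>carrier (nc_torus q). g \<oplus>\<^bsub>nc_torus q\<^esub> f = \<zero>\<^bsub>nc_torus q\<^esub>"
    if "f \<in> carrier (nc_torus q)" for f
    using that by (intro bexI[of _ "\<lambda>x. - f x"]) (auto simp: schwartz_uminus)
qed (auto simp: schwartz_add(1) add_ac)

lemma ring_nc_torus: "ring (nc_torus q)"
proof (rule ringI)
  show "Group.monoid (nc_torus q)"
    by (rule monoidI) (auto simp: conv_closed conv_assoc conv_one_left conv_one_right)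
qed (auto simp: abelian_group_nc_torus conv_add_left conv_add_right)

lemma complex_ring_simps [simp]:
  "carrier complex_ring = UNIV" "\<one>\<^bsub>complex_ring\<^esub> = 1" "\<zero>\<^bsub>complex_ring\<^esub> = 0"
  "a \<otimes>\<^bsub>complex_ring\<^esub> b = a * b" "a \<oplus>\<^bsub>complex_ring\<^esub> b = a + b"
  by (simp_all add: complex_ring_def)

lemma cring_complex_ring: "cring complex_ring"
proof (rule cringI)
  show "abelian_group complex_ring"
  proof (rule abelian_groupI)
    show "\<exists>y\<in>carrier complex_ring. y \<oplus>\<^bsub>complex_ring\<^esub> x = \<zero>\<^bsub>complex_ring\<^esub>" for x
      by (intro bexI[of _ "- x"]) auto
  qed auto
  show "comm_monoid complex_ring"
    by (rule comm_monoidI) auto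
qed (auto simp: distrib_right)

lemma star_algebra_nc_torus: "star_algebra (nc_torus q)"
proof (intro star_algebra.intro star_algebra_axioms.intro ring_nc_torus)
  show "Module.module complex_ring (nc_torus q)"
    by (rule moduleI) (auto simp: cring_complex_ring abelian_group_nc_torus schwartz_cmult(1)
        algebra_simps)
qed (auto simp: conv_cmult_left conv_cmult_right conv_star_closed conv_star_involution conv_star_conv
    conv_star_def algebra_simps)

sublocale torus: star_algebra "nc_torus q"
  by (rule star_algebra_nc_torus)

lemma torus_uminus [simp]:
  assumes "f \<in> schwartz"
  shows "\<ominus>\<^bsub>nc_torus q\<^esub> f = (\<lambda>x. - f x)"
  using abelian_group.minus_equality[OF abelian_group_nc_torus, of "\<lambda>x. - f x" f] assms
  by (simp add: schwartz_uminus)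

lemma torus_diff [simp]:
  assumes "g \<in> schwartz"
  shows "f \<ominus>\<^bsub>nc_torus q\<^esub> g = (\<lambda>x. f x - g x)"
  using assms by (simp add: a_minus_def)

lemma schwartz_diff:
  assumes "f \<in> schwartz" "g \<in> schwartz"
  shows "(\<lambda>x. f x - g x) \<in> schwartz"
    and "torus_norm m (\<lambda>x. f x - g x) \<le> torus_norm m f + torus_norm m g"
proof -
  have n: "torus_norm m (\<lambda>x. - g x) \<le> torus_norm m g"
    using schwartz_cmult(2)[OF assms(2), of m "-1"] by simp
  show "(\<lambda>x. f x - g x) \<in> schwartz"
    using schwartz_add(1)[OF assms(1) schwartz_uminus[OF assms(2)]] by simp
  show "torus_norm m (\<lambda>x. f x - g x) \<le> torus_norm m f + torus_norm m g"
    using schwartz_add(2)[OF assms(1) schwartz_uminus[OF assms(2)], of m] n by simp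
qed

lemma conv_diff_left:
  assumes "f \<in> schwartz" "g \<in> schwartz" "h \<in> schwartz"
  shows "twisted_conv q (\<lambda>x. f x - g x) h = (\<lambda>x. twisted_conv q f h x - twisted_conv q g h x)"
  using conv_add_left[OF assms(1) schwartz_uminus[OF assms(2)] assms(3)]
    conv_cmult_left[of "-1" g h] by simp

lemma conv_diff_right:
  assumes "f \<in> schwartz" "g \<in> schwartz" "h \<in> schwartz"
  shows "twisted_conv q f (\<lambda>x. g x - h x) = (\<lambda>x. twisted_conv q f g x - twisted_conv q f h x)"
  using conv_add_right[OF assms(1,2) schwartz_uminus[OF assms(3)]]
    conv_cmult_right[of f "-1" h] by simp

lemma torus_norm_zero [simp]: "torus_norm m (\<lambda>_. 0) = 0"
  using torus_norm_least[of "\<lambda>_. 0" m 0] torus_norm_nonneg[OF schwartz_zero, of m] by simp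

section \<open>Completeness of the Frechet topology\<close>

lemma subadditive_torus_norm: "subadditive (nc_torus q) (range torus_norm)"
  by (auto simp: subadditive_def schwartz_add(2))

text \<open>A Cauchy filter for the Frechet norms has coefficientwise limits because each coefficient is bounded by
  \<open>torus_norm 0\<close>. The Cauchy estimates are uniform in the index, so they pass to the limit in the second
  argument; this shows at once that the limit is rapidly decreasing and that the filter
  converges to it in every norm.\<close>
lemma torus_norm_complete: "seminorm_complete (nc_torus q) (range torus_norm)"
  unfolding seminorm_complete_def
proof (intro allI impI)
  fix F :: "(int \<times> int \<Rightarrow> complex) filter"
  assume F: "F \<noteq> bot" "F \<le> principal (carrier (nc_torus q))"
    and C: "\<forall>p\<in>range torus_norm. \<forall>e>0. \<forall>\<^sub>F (f, g) in F \<times>\<^sub>F F. p (f \<ominus>\<^bsub>nc_torus q\<^esub> g) < e"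
  have carr: "\<forall>\<^sub>F f in F. f \<in> schwartz" using F(2) by (simp add: le_principal)
  have cauchy: "\<exists>P. eventually P F \<and> (\<forall>f. P f \<longrightarrow> f \<in> schwartz) \<and>
      (\<forall>f g x. P f \<and> P g \<longrightarrow> cmod (f x - g x) * weight x ^ m < e)" if e: "e > 0" for m e
  proof -
    have "\<forall>\<^sub>F (f, g) in F \<times>\<^sub>F F. torus_norm m (f \<ominus>\<^bsub>nc_torus q\<^esub> g) < e"
      using C e by blast
    then obtain P Q where PQ: "eventually P F" "eventually Q F"
      "\<And>f g. P f \<Longrightarrow> Q g \<Longrightarrow> torus_norm m (f \<ominus>\<^bsub>nc_torus q\<^esub> g) < e"
      unfolding eventually_prod_filter by auto
    show ?thesis
    proof (intro exI[of _ "\<lambda>f. P f \<and> Q f \<and> f \<in> schwartz"] conjI allI impI)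
      show "\<forall>\<^sub>F f in F. P f \<and> Q f \<and> f \<in> schwartz"
        using PQ(1,2) carr by (simp add: eventually_conj)
      fix f g x assume fg: "(P f \<and> Q f \<and> f \<in> schwartz) \<and> (P g \<and> Q g \<and> g \<in> schwartz)"
      then have "torus_norm m (\<lambda>x. f x - g x) < e" using PQ(3)[of f g] by simp
      then show "cmod (f x - g x) * weight x ^ m < e"
        using torus_norm_upper[OF schwartz_diff(1), of f g x m] fg by simp
    qed simp
  qed
  have "\<exists>c. ((\<lambda>f. f x) \<longlongrightarrow> c) F" for x
  proof -
    have "cauchy_filter (filtermap (\<lambda>f. f x) F)"
      unfolding cauchy_filter_metric_filtermap
    proof (intro allI impI)
      fix e :: real assume "e > 0"
      then show "\<exists>P. eventually P F \<and> (\<forall>f g. P f \<and> P g \<longrightarrow> dist (f x) (g x) < e)"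
        using cauchy[of e 0] by (simp add: dist_norm) blast
    qed
    moreover have "filtermap (\<lambda>f. f x) F \<noteq> bot" using F(1) by (simp add: filtermap_bot_iff)
    ultimately show ?thesis
      using complete_UNIV[where 'a = complex] unfolding complete_uniform filterlim_def by auto
  qed
  then obtain l where l: "\<And>x. ((\<lambda>f. f x) \<longlongrightarrow> l x) F" by metis
  have near: "\<forall>\<^sub>F f in F. f \<in> schwartz \<and> (\<forall>x. cmod (f x - l x) * weight x ^ m \<le> e)"
    if e: "e > 0" for m e
  proof -
    obtain P where P: "eventually P F" "\<forall>f. P f \<longrightarrow> f \<in> schwartz"
      "\<forall>f g x. P f \<and> P g \<longrightarrow> cmod (f x - g x) * weight x ^ m < e"
      using cauchy[OF e] by blast
    have "cmod (f x - l x) * weight x ^ m \<le> e" if f: "P f" for f x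
    proof (rule tendsto_upperbound)
      show "((\<lambda>g. cmod (f x - g x) * weight x ^ m) \<longlongrightarrow> cmod (f x - l x) * weight x ^ m) F"
        by (intro tendsto_intros l)
      show "\<forall>\<^sub>F g in F. cmod (f x - g x) * weight x ^ m \<le> e"
        using P(1) by eventually_elim (use P(3) f less_imp_le in blast)
    qed (rule F(1))
    then show ?thesis using eventually_mono[OF P(1)] P(2) by simp
  qed
  have lS: "l \<in> schwartz"
  proof (rule schwartzI)
    fix m
    obtain f where f: "f \<in> schwartz" "\<And>x. cmod (f x - l x) * weight x ^ m \<le> 1"
      using eventually_happens'[OF F(1) near[of 1 m]] zero_less_one by blast
    have "cmod (l x) * weight x ^ m \<le> torus_norm m f + 1" for x
    proof -
      have "cmod (l x) \<le> cmod (f x) + cmod (f x - l x)"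
        using norm_triangle_ineq4[of "f x" "f x - l x"] by simp
      then have "cmod (l x) * weight x ^ m \<le> (cmod (f x) + cmod (f x - l x)) * weight x ^ m"
        by (rule mult_right_mono) simp
      then show ?thesis
        using f(2)[of x] torus_norm_upper[OF f(1), of x m] by (simp add: distrib_right)
    qed
    then show "\<exists>C. \<forall>x. cmod (l x) * weight x ^ m \<le> C" by blast
  qed
  have "limitin (seminorm_topology (nc_torus q) (range torus_norm)) (\<lambda>f. f) l F"
  proof (rule torus.limitin_seminorm_topology[OF subadditive_torus_norm _ F(2)])
    show "l \<in> carrier (nc_torus q)" using lS by simp
    fix p and e :: real assume p: "p \<in> range torus_norm" and e: "e > 0"
    then obtain m where m: "p = torus_norm m" by blast
    have "\<forall>\<^sub>F f in F. f \<in> schwartz \<and> (\<forall>x. cmod (f x - l x) * weight x ^ m \<le> e / 2)"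
      by (rule near) (use e in simp)
    then show "\<forall>\<^sub>F f in F. p (f \<ominus>\<^bsub>nc_torus q\<^esub> l) < e"
    proof eventually_elim
      case (elim f)
      then have "torus_norm m (\<lambda>x. f x - l x) \<le> e / 2" by (intro torus_norm_least) simp
      then show ?case using e lS m by simp
    qed
  qed
  then show "\<exists>l. limitin (seminorm_topology (nc_torus q) (range torus_norm)) (\<lambda>f. f) l F" by blast
qed

section \<open>Bounded forms and bounded derivations\<close>

definition bounded_forms :: "((int \<times> int \<Rightarrow> complex) \<Rightarrow> complex) set" where
  "bounded_forms = {\<phi> \<in> positive_forms (nc_torus q).
     \<exists>n. \<exists>C\<ge>0. \<forall>f\<in>schwartz. cmod (\<phi> f) \<le> C * torus_norm n f}"

definition bounded_operator :: "((int \<times> int \<Rightarrow> complex) \<Rightarrow> int \<times> int \<Rightarrow> complex) \<Rightarrow> bool" where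
  "bounded_operator X \<longleftrightarrow> X ` schwartz \<subseteq> schwartz \<and>
     (\<forall>m. \<exists>n. \<exists>C\<ge>0. \<forall>f\<in>schwartz. torus_norm m (X f) \<le> C * torus_norm n f)"

definition bounded_derivations :: "((int \<times> int \<Rightarrow> complex) \<Rightarrow> int \<times> int \<Rightarrow> complex) set" where
  "bounded_derivations = {X \<in> derivations (nc_torus q). bounded_operator X}"

lemma derivations_nc_torus:
  "X \<in> derivations (nc_torus q) \<longleftrightarrow> X \<in> schwartz \<rightarrow>\<^sub>E schwartz \<and>
     (\<forall>f\<in>schwartz. \<forall>g\<in>schwartz. X (\<lambda>x. f x + g x) = (\<lambda>x. X f x + X g x)) \<and>
     (\<forall>c. \<forall>f\<in>schwartz. X (\<lambda>x. c * f x) = (\<lambda>x. c * X f x)) \<and>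
     (\<forall>f\<in>schwartz. \<forall>g\<in>schwartz. X (twisted_conv q f g) =
        (\<lambda>x. twisted_conv q (X f) g x + twisted_conv q f (X g) x))"
  by (simp add: derivations_def)

lemma derivationD:
  assumes "X \<in> derivations (nc_torus q)" "f \<in> schwartz"
  shows "X f \<in> schwartz"
    and "g \<in> schwartz \<Longrightarrow> X (\<lambda>x. f x + g x) = (\<lambda>x. X f x + X g x)"
    and "X (\<lambda>x. c * f x) = (\<lambda>x. c * X f x)"
    and "g \<in> schwartz \<Longrightarrow> X (twisted_conv q f g) =
        (\<lambda>x. twisted_conv q (X f) g x + twisted_conv q f (X g) x)"
  using assms by (auto simp: derivations_nc_torus)

lemma bounded_operatorI:
  assumes "\<And>f. f \<in> schwartz \<Longrightarrow> X f \<in> schwartz"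
    and "\<And>m. \<exists>n C. C \<ge> 0 \<and> (\<forall>f\<in>schwartz. torus_norm m (X f) \<le> C * torus_norm n f)"
  shows "bounded_operator X"
  using assms unfolding bounded_operator_def by blast

lemma bounded_operator_estimate:
  assumes "bounded_operator X"
  shows "\<exists>n C. C \<ge> 0 \<and> (\<forall>f\<in>schwartz. torus_norm m (X f) \<le> C * torus_norm n f)"
  using assms unfolding bounded_operator_def by blast

lemma bounded_operator_closed: "bounded_operator X \<Longrightarrow> f \<in> schwartz \<Longrightarrow> X f \<in> schwartz"
  unfolding bounded_operator_def by blast

lemma bounded_operator_comp:
  assumes X: "bounded_operator X" and Y: "bounded_operator Y"
  shows "bounded_operator (\<lambda>f. X (Y f))"
proof (rule bounded_operatorI)
  show "X (Y f) \<in> schwartz" if "f \<in> schwartz" for f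
    using that X Y by (simp add: bounded_operator_closed)
  fix m
  obtain n C where C: "C \<ge> 0" "\<And>f. f \<in> schwartz \<Longrightarrow> torus_norm m (X f) \<le> C * torus_norm n f"
    using bounded_operator_estimate[OF X, of m] by blast
  obtain k B where B: "B \<ge> 0" "\<And>f. f \<in> schwartz \<Longrightarrow> torus_norm n (Y f) \<le> B * torus_norm k f"
    using bounded_operator_estimate[OF Y, of n] by blast
  have "torus_norm m (X (Y f)) \<le> C * B * torus_norm k f" if f: "f \<in> schwartz" for f
    using C(2)[OF bounded_operator_closed[OF Y f]] mult_left_mono[OF B(2)[OF f] C(1)]
    by (simp add: mult.assoc)
  then show "\<exists>n C. C \<ge> 0 \<and> (\<forall>f\<in>schwartz. torus_norm m (X (Y f)) \<le> C * torus_norm n f)"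
    using B(1) C(1) by (intro exI[of _ k] exI[of _ "C * B"]) simp
qed

lemma bounded_operator_add:
  assumes X: "bounded_operator X" and Y: "bounded_operator Y"
  shows "bounded_operator (\<lambda>f x. X f x + Y f x)"
proof (rule bounded_operatorI)
  show "(\<lambda>x. X f x + Y f x) \<in> schwartz" if "f \<in> schwartz" for f
    using that X Y by (simp add: bounded_operator_closed schwartz_add(1))
  fix m
  obtain n C where C: "C \<ge> 0" "\<And>f. f \<in> schwartz \<Longrightarrow> torus_norm m (X f) \<le> C * torus_norm n f"
    using bounded_operator_estimate[OF X, of m] by blast
  obtain k B where B: "B \<ge> 0" "\<And>f. f \<in> schwartz \<Longrightarrow> torus_norm m (Y f) \<le> B * torus_norm k f"
    using bounded_operator_estimate[OF Y, of m] by blast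
  have "torus_norm m (\<lambda>x. X f x + Y f x) \<le> (C + B) * torus_norm (max n k) f" if f: "f \<in> schwartz" for f
  proof -
    have "torus_norm m (\<lambda>x. X f x + Y f x) \<le> torus_norm m (X f) + torus_norm m (Y f)"
      using f X Y by (simp add: bounded_operator_closed schwartz_add(2))
    also have "\<dots> \<le> C * torus_norm n f + B * torus_norm k f"
      using B(2)[OF f] C(2)[OF f] by (rule add_mono[rotated])
    also have "\<dots> \<le> C * torus_norm (max n k) f + B * torus_norm (max n k) f"
      by (intro add_mono mult_left_mono torus_norm_mono f B(1) C(1)) auto
    finally show ?thesis by (simp add: distrib_right)
  qed
  then show "\<exists>n C. C \<ge> 0 \<and> (\<forall>f\<in>schwartz. torus_norm m (\<lambda>x. X f x + Y f x) \<le> C * torus_norm n f)"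
    using B(1) C(1) by (intro exI[of _ "max n k"] exI[of _ "C + B"]) simp
qed

lemma bounded_operator_cmult: "bounded_operator (\<lambda>f x. c * f x)"
proof (rule bounded_operatorI)
  fix m
  show "\<exists>n C. C \<ge> 0 \<and> (\<forall>f\<in>schwartz. torus_norm m (\<lambda>x. c * f x) \<le> C * torus_norm n f)"
    by (intro exI[of _ m] exI[of _ "cmod c"]) (simp add: schwartz_cmult(2))
qed (rule schwartz_cmult(1))

lemma bounded_operator_conv_left:
  assumes z: "z \<in> schwartz"
  shows "bounded_operator (twisted_conv q z)"
proof (rule bounded_operatorI)
  fix m
  show "\<exists>n C. C \<ge> 0 \<and> (\<forall>f\<in>schwartz. torus_norm m (twisted_conv q z f) \<le> C * torus_norm n f)"
    using conv_norm[OF z] z weight_mass_nonneg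
    by (intro exI[of _ m] exI[of _ "weight_mass * torus_norm (m + 4) z"]) (simp add: torus_norm_nonneg)
qed (rule conv_closed[OF z])

lemma bounded_operator_conv_right:
  assumes z: "z \<in> schwartz"
  shows "bounded_operator (\<lambda>f. twisted_conv q f z)"
proof (rule bounded_operatorI)
  fix m
  show "\<exists>n C. C \<ge> 0 \<and> (\<forall>f\<in>schwartz. torus_norm m (twisted_conv q f z) \<le> C * torus_norm n f)"
    using conv_norm[OF _ z, of _ m] z weight_mass_nonneg
    by (intro exI[of _ "m + 4"] exI[of _ "weight_mass * torus_norm m z"])
      (simp add: torus_norm_nonneg mult_ac)
qed (simp add: conv_closed z)

lemma bounded_operator_cong:
  assumes "\<And>f. f \<in> schwartz \<Longrightarrow> X f = Y f" "bounded_operator X"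
  shows "bounded_operator Y"
  using assms unfolding bounded_operator_def by (simp add: image_subset_iff)


text \<open>Restriction to the carrier is built in here once, so that closure properties reduce to pointwise
  identities between coefficient functions.\<close>
lemma bounded_derivationI:
  assumes "bounded_operator X"
    and "\<And>f g x. f \<in> schwartz \<Longrightarrow> g \<in> schwartz \<Longrightarrow> X (\<lambda>x. f x + g x) x = X f x + X g x"
    and "\<And>c f x. f \<in> schwartz \<Longrightarrow> X (\<lambda>x. c * f x) x = c * X f x"
    and "\<And>f g x. f \<in> schwartz \<Longrightarrow> g \<in> schwartz \<Longrightarrow>
      X (twisted_conv q f g) x = twisted_conv q (X f) g x + twisted_conv q f (X g) x"
  shows "(\<lambda>f\<in>schwartz. X f) \<in> bounded_derivations"
proof -
  have "bounded_operator (\<lambda>f\<in>schwartz. X f)"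
    by (rule bounded_operator_cong[OF _ assms(1)]) simp
  then show ?thesis
    using bounded_operator_closed[OF assms(1)] assms(2-4)
    by (simp add: bounded_derivations_def derivations_nc_torus schwartz_add(1) schwartz_cmult(1)
        conv_closed fun_eq_iff)
qed

lemma zero_derivation: "(\<lambda>f\<in>schwartz. \<lambda>_. 0) \<in> bounded_derivations"
proof (rule bounded_derivationI)
  show "bounded_operator (\<lambda>f _. 0)" using bounded_operator_cmult[of 0] by simp
qed (simp_all add: twisted_conv_def)

lemma add_derivation:
  assumes "X \<in> bounded_derivations" "Y \<in> bounded_derivations"
  shows "(\<lambda>f\<in>schwartz. \<lambda>x. X f x + Y f x) \<in> bounded_derivations"
proof -
  have X: "X \<in> derivations (nc_torus q)" "bounded_operator X"
    and Y: "Y \<in> derivations (nc_torus q)" "bounded_operator Y"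
    using assms by (auto simp: bounded_derivations_def)
  note D = derivationD[OF X(1)] derivationD[OF Y(1)]
  show ?thesis
  proof (rule bounded_derivationI)
    show "bounded_operator (\<lambda>f x. X f x + Y f x)" by (rule bounded_operator_add[OF X(2) Y(2)])
  qed (simp_all add: D conv_add_left conv_add_right distrib_left)
qed

lemma cmult_derivation:
  assumes "X \<in> bounded_derivations"
  shows "(\<lambda>f\<in>schwartz. \<lambda>x. c * X f x) \<in> bounded_derivations"
proof -
  have X: "X \<in> derivations (nc_torus q)" "bounded_operator X"
    using assms by (auto simp: bounded_derivations_def)
  note D = derivationD[OF X(1)]
  show ?thesis
  proof (rule bounded_derivationI)
    show "bounded_operator (\<lambda>f x. c * X f x)"
      by (rule bounded_operator_comp[OF bounded_operator_cmult X(2)])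
  qed (simp_all add: D conv_cmult_left conv_cmult_right distrib_left)
qed

lemma commutator_derivation:
  assumes "X \<in> bounded_derivations" "Y \<in> bounded_derivations"
  shows "(\<lambda>f\<in>schwartz. \<lambda>x. X (Y f) x - Y (X f) x) \<in> bounded_derivations"
proof -
  have X: "X \<in> derivations (nc_torus q)" "bounded_operator X"
    and Y: "Y \<in> derivations (nc_torus q)" "bounded_operator Y"
    using assms by (auto simp: bounded_derivations_def)
  note D = derivationD[OF X(1)] derivationD[OF Y(1)]
  show ?thesis
  proof (rule bounded_derivationI)
    have "bounded_operator (\<lambda>f x. X (Y f) x + (- 1) * Y (X f) x)"
      by (rule bounded_operator_add[OF bounded_operator_comp[OF X(2) Y(2)]
            bounded_operator_comp[OF bounded_operator_cmult bounded_operator_comp[OF Y(2) X(2)]]])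
    then show "bounded_operator (\<lambda>f x. X (Y f) x - Y (X f) x)" by simp
  qed (simp_all add: D conv_closed conv_diff_left conv_diff_right right_diff_distrib)
qed

text \<open>Commuting with \<open>z\<close> is what moves it past the left factor in the Leibniz rule.\<close>
lemma center_derivation:
  assumes "z \<in> center (nc_torus q)" "X \<in> bounded_derivations"
  shows "(\<lambda>f\<in>schwartz. twisted_conv q z (X f)) \<in> bounded_derivations"
proof -
  have z: "z \<in> schwartz" "\<And>f. f \<in> schwartz \<Longrightarrow> twisted_conv q z f = twisted_conv q f z"
    using assms(1) by (auto simp: center_def)
  have X: "X \<in> derivations (nc_torus q)" "bounded_operator X"
    using assms(2) by (auto simp: bounded_derivations_def)
  note D = derivationD[OF X(1)]
  show ?thesis
  proof (rule bounded_derivationI)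
    show "bounded_operator (\<lambda>f. twisted_conv q z (X f))"
      by (rule bounded_operator_comp[OF bounded_operator_conv_left[OF z(1)] X(2)])
    fix f g x
    assume f: "f \<in> schwartz" and g: "g \<in> schwartz"
    have "twisted_conv q z (twisted_conv q f (X g)) = twisted_conv q f (twisted_conv q z (X g))"
      using f g z(1) D(1) by (simp add: z(2)[OF f] flip: conv_assoc)
    then show "twisted_conv q z (X (twisted_conv q f g)) x =
        twisted_conv q (twisted_conv q z (X f)) g x + twisted_conv q f (twisted_conv q z (X g)) x"
      using f g z(1) by (simp add: D conv_closed conv_add_right conv_assoc)
  qed (simp_all add: D z(1) conv_add_right conv_cmult_right)
qed

section \<open>The grading derivations and the trace\<close>

definition grading_derivation ::
  "(int \<times> int \<Rightarrow> int) \<Rightarrow> (int \<times> int \<Rightarrow> complex) \<Rightarrow> int \<times> int \<Rightarrow> complex" where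
  "grading_derivation a = (\<lambda>f\<in>schwartz. \<lambda>x. of_int (a x) * f x)"

lemma grading_bound:
  assumes a: "\<And>x. \<bar>real_of_int (a x)\<bar> \<le> weight x" and f: "f \<in> schwartz"
  shows "cmod (of_int (a x) * f x) * weight x ^ m \<le> torus_norm (m + 1) f"
proof -
  have "cmod (of_int (a x) * f x) * weight x ^ m = \<bar>real_of_int (a x)\<bar> * (cmod (f x) * weight x ^ m)"
    by (simp add: norm_mult)
  also have "\<dots> \<le> weight x * (cmod (f x) * weight x ^ m)"
    by (intro mult_right_mono a) simp
  also have "\<dots> \<le> torus_norm (m + 1) f"
    using torus_norm_upper[OF f, of x "m + 1"] by (simp add: mult_ac)
  finally show ?thesis .
qed

text \<open>The Leibniz rule holds because \<open>a x = a y + a (x - y)\<close> in each term of the convolution. For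
  the two coordinates these are, up to the factor \<open>\<i>\<close>, the infinitesimal generators of the action of
  the classical torus that rotates \<open>U\<close> and \<open>V\<close>.\<close>
lemma grading_bounded_derivation:
  assumes a: "\<And>x. \<bar>real_of_int (a x)\<bar> \<le> weight x" and add: "\<And>x y. a (x + y) = a x + a y"
  shows "grading_derivation a \<in> bounded_derivations"
proof -
  have closed: "(\<lambda>x. of_int (a x) * f x) \<in> schwartz" if "f \<in> schwartz" for f
    using grading_bound[OF a that] by (intro schwartzI) blast
  have "bounded_operator (\<lambda>f x. of_int (a x) * f x)"
  proof (rule bounded_operatorI)
    fix m
    have "torus_norm m (\<lambda>x. of_int (a x) * f x) \<le> 1 * torus_norm (m + 1) f" if "f \<in> schwartz" for f
      using grading_bound[OF a that] by (auto intro!: torus_norm_least)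
    then show "\<exists>n C. C \<ge> 0 \<and>
        (\<forall>f\<in>schwartz. torus_norm m (\<lambda>x. of_int (a x) * f x) \<le> C * torus_norm n f)"
      by (intro exI[of _ "m + 1"] exI[of _ 1]) simp
  qed (rule closed)
  moreover have "of_int (a x) * twisted_conv q f g x =
      twisted_conv q (\<lambda>x. of_int (a x) * f x) g x + twisted_conv q f (\<lambda>x. of_int (a x) * g x) x"
    if f: "f \<in> schwartz" and g: "g \<in> schwartz" for f g x
  proof -
    have ax: "a x = a y + a (x - y)" for y
      using add[of y "x - y"] by simp
    have "twisted_conv q (\<lambda>x. of_int (a x) * f x) g x + twisted_conv q f (\<lambda>x. of_int (a x) * g x) x =
        (\<Sum>\<^sub>\<infinity>y\<in>UNIV. of_int (a y) * f y * g (x - y) * cocycle q y (x - y) +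
           f y * (of_int (a (x - y)) * g (x - y)) * cocycle q y (x - y))"
      unfolding twisted_conv_def
      by (rule infsum_add[symmetric]; rule abs_summable_summable; rule conv_term_summable)
        (simp_all add: f g closed)
    also have "\<dots> = (\<Sum>\<^sub>\<infinity>y\<in>UNIV. of_int (a x) * (f y * g (x - y) * cocycle q y (x - y)))"
    proof (rule infsum_cong)
      fix y
      show "of_int (a y) * f y * g (x - y) * cocycle q y (x - y) +
          f y * (of_int (a (x - y)) * g (x - y)) * cocycle q y (x - y) =
          of_int (a x) * (f y * g (x - y) * cocycle q y (x - y))"
        unfolding ax[of y] by (simp add: algebra_simps)
    qed
    finally show ?thesis by (simp add: twisted_conv_def infsum_cmult_right')
  qed
  ultimately show ?thesis
    unfolding grading_derivation_def
    by (intro bounded_derivationI) (simp_all add: distrib_left)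
qed

lemma fst_derivation: "grading_derivation fst \<in> bounded_derivations"
  by (rule grading_bounded_derivation) (auto simp: weight_def)

lemma snd_derivation: "grading_derivation snd \<in> bounded_derivations"
  by (rule grading_bounded_derivation) (auto simp: weight_def)

lemma grading_derivation_iterate:
  assumes "grading_derivation a \<in> bounded_derivations" "f \<in> schwartz"
  shows "foldr (\<circ>) (replicate m (grading_derivation a)) id f = (\<lambda>x. of_int (a x) ^ m * f x)
    \<and> (\<lambda>x. of_int (a x) ^ m * f x) \<in> schwartz"
proof (induction m)
  case 0
  then show ?case using assms(2) by simp
next
  case (Suc m)
  have "grading_derivation a (\<lambda>x. of_int (a x) ^ m * f x) \<in> schwartz"
    using Suc assms(1) by (auto simp: bounded_derivations_def intro: bounded_operator_closed)
  then show ?case using Suc by (simp add: grading_derivation_def mult.assoc)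
qed

lemma derivation_one:
  assumes "X \<in> derivations (nc_torus q)"
  shows "X (\<lambda>x. if x = 0 then 1 else 0) = (\<lambda>_. 0)"
proof -
  let ?e = "\<lambda>x :: int \<times> int. if x = 0 then 1 else 0 :: complex"
  have "X ?e = X (twisted_conv q ?e ?e)" by (simp add: conv_one_left)
  also have "\<dots> = (\<lambda>x. X ?e x + X ?e x)"
    using derivationD(4)[OF assms schwartz_one schwartz_one] by (simp add: conv_one_left conv_one_right)
  finally show ?thesis by (simp add: fun_eq_iff)
qed

text \<open>An element annihilated by both grading derivations has no coefficient outside \<open>0\<close>; conversely every
  derivation annihilates the unit.\<close>
lemma torus_common_kernel:
  "{f \<in> carrier (nc_torus q). \<forall>X\<in>bounded_derivations. X f = \<zero>\<^bsub>nc_torus q\<^esub>} =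
     range (\<lambda>c. c \<odot>\<^bsub>nc_torus q\<^esub> \<one>\<^bsub>nc_torus q\<^esub>)"
proof (intro equalityI subsetI)
  fix f assume "f \<in> {f \<in> carrier (nc_torus q). \<forall>X\<in>bounded_derivations. X f = \<zero>\<^bsub>nc_torus q\<^esub>}"
  then have f: "f \<in> schwartz" and ker: "\<And>X. X \<in> bounded_derivations \<Longrightarrow> X f = (\<lambda>_. 0)" by auto
  have "f x = 0" if "x \<noteq> 0" for x
  proof -
    have "fst x \<noteq> 0 \<or> snd x \<noteq> 0" using that by (simp add: prod_eq_iff)
    then show ?thesis
      using fun_cong[OF ker[OF fst_derivation], of x] fun_cong[OF ker[OF snd_derivation], of x] f
      by (auto simp: grading_derivation_def)
  qed
  then have "f = (\<lambda>x. f 0 * (if x = 0 then 1 else 0))" by auto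
  then show "f \<in> range (\<lambda>c. c \<odot>\<^bsub>nc_torus q\<^esub> \<one>\<^bsub>nc_torus q\<^esub>)" by auto
next
  fix f assume "f \<in> range (\<lambda>c. c \<odot>\<^bsub>nc_torus q\<^esub> \<one>\<^bsub>nc_torus q\<^esub>)"
  then obtain c where f: "f = (\<lambda>x. c * (if x = 0 then 1 else 0))" by auto
  have "X f = (\<lambda>_. 0)" if "X \<in> bounded_derivations" for X
    using that unfolding f by (subst derivationD(3)) (auto simp: bounded_derivations_def derivation_one)
  moreover have "f \<in> schwartz" unfolding f by (intro schwartz_cmult(1) schwartz_one)
  ultimately show "f \<in> {f \<in> carrier (nc_torus q). \<forall>X\<in>bounded_derivations. X f = \<zero>\<^bsub>nc_torus q\<^esub>}"
    by simp
qed

definition torus_trace :: "(int \<times> int \<Rightarrow> complex) \<Rightarrow> complex" where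
  "torus_trace = (\<lambda>f\<in>schwartz. f 0)"

text \<open>The sum of squares bounds each of its terms, so the seminorm of the trace controls all
  coefficients at once.\<close>
lemma torus_trace_square:
  assumes f: "f \<in> schwartz"
  shows "torus_trace (twisted_conv q (conv_star f) f) = of_real (\<Sum>\<^sub>\<infinity>x\<in>UNIV. (cmod (f x))\<^sup>2)"
    and "(cmod (f x))\<^sup>2 \<le> (\<Sum>\<^sub>\<infinity>x\<in>UNIV. (cmod (f x))\<^sup>2)"
proof -
  have s: "(\<lambda>x. (cmod (f x))\<^sup>2) summable_on UNIV"
  proof (rule summable_on_comparison_test)
    show "(\<lambda>x. cmod (f x) * torus_norm 0 f) summable_on UNIV"
      by (rule summable_on_cmult_left[OF schwartz_abs_summable[OF f]])
    show "(cmod (f x))\<^sup>2 \<le> cmod (f x) * torus_norm 0 f" for x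
      using schwartz_bound[OF f, of x] by (simp add: power2_eq_square mult_left_mono)
  qed simp
  have "torus_trace (twisted_conv q (conv_star f) f) = twisted_conv q (conv_star f) f 0"
    using f by (simp add: torus_trace_def conv_closed conv_star_closed)
  also have "\<dots> = (\<Sum>\<^sub>\<infinity>x\<in>UNIV. complex_of_real ((cmod (f x))\<^sup>2))"
    unfolding twisted_conv_def
  proof (rule infsum_reindex_bij_witness[where i = uminus and j = uminus])
    fix y :: "int \<times> int"
    have "cocycle q y y * cocycle q y (- y) = 1"
      by (simp add: cocycle_def flip: power_int_add)
    then have eq: "conv_star f y * f (- y) * cocycle q y (- y) = cnj (f (- y)) * f (- y)"
      by (simp add: conv_star_def)
    show "complex_of_real ((cmod (f (- y)))\<^sup>2) = conv_star f y * f (0 - y) * cocycle q y (0 - y)"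
      unfolding complex_norm_square diff_0 eq by (rule mult.commute)
  qed auto
  also have "\<dots> = of_real (\<Sum>\<^sub>\<infinity>x\<in>UNIV. (cmod (f x))\<^sup>2)"
    by (rule infsumI) (rule has_sum_of_real[OF has_sum_infsum[OF s]])
  finally show "torus_trace (twisted_conv q (conv_star f) f) = of_real (\<Sum>\<^sub>\<infinity>x\<in>UNIV. (cmod (f x))\<^sup>2)" .
  show "(cmod (f x))\<^sup>2 \<le> (\<Sum>\<^sub>\<infinity>x\<in>UNIV. (cmod (f x))\<^sup>2)"
    using finite_sum_le_infsum[OF s, of "{x}"] by simp
qed

lemma torus_trace_bounded: "torus_trace \<in> bounded_forms"
proof -
  have "torus_trace \<in> positive_forms (nc_torus q)"
    by (auto simp: positive_forms_def linear_forms_def torus_trace_square(1) infsum_nonneg)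
      (auto simp: torus_trace_def schwartz_add(1) schwartz_cmult(1))
  moreover have "cmod (torus_trace f) \<le> 1 * torus_norm 0 f" if "f \<in> schwartz" for f
    using schwartz_bound[OF that, of 0] that by (simp add: torus_trace_def)
  ultimately show ?thesis
    unfolding bounded_forms_def using zero_le_one by blast
qed

lemma trace_seminorm_coeff:
  assumes "f \<in> schwartz"
  shows "cmod (f x) \<le> form_seminorm (nc_torus q) torus_trace f"
  using real_sqrt_le_mono[OF torus_trace_square(2)[OF assms, of x]]
  by (simp add: form_seminorm_def torus_trace_square(1)[OF assms])

lemma bounded_form_estimate:
  assumes "\<phi> \<in> bounded_forms"
  shows "\<exists>n C. C \<ge> 0 \<and> (\<forall>f\<in>schwartz. cmod (\<phi> f) \<le> C * torus_norm n f)"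
  using assms unfolding bounded_forms_def by blast

text \<open>The form is composed with the sandwich operator \<open>g \<mapsto> f\<^sup>* g f\<close>, which is continuous and maps
  \<open>g\<^sup>* g\<close> to \<open>(g f)\<^sup>* (g f)\<close>.\<close>
lemma bounded_forms_invariant:
  assumes f: "f \<in> schwartz" and \<phi>: "\<phi> \<in> bounded_forms"
  shows "form_action (nc_torus q) f \<phi> \<in> bounded_forms"
proof -
  have lin: "\<And>g h. g \<in> schwartz \<Longrightarrow> h \<in> schwartz \<Longrightarrow> \<phi> (\<lambda>x. g x + h x) = \<phi> g + \<phi> h"
      "\<And>c g. g \<in> schwartz \<Longrightarrow> \<phi> (\<lambda>x. c * g x) = c * \<phi> g"
      "\<And>g. g \<in> schwartz \<Longrightarrow> \<phi> (twisted_conv q (conv_star g) g) \<in> \<real>\<^sub>\<ge>\<^sub>0"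
    using \<phi> by (auto simp: bounded_forms_def positive_forms_def linear_forms_def)
  obtain n C where C: "C \<ge> 0" "\<And>g. g \<in> schwartz \<Longrightarrow> cmod (\<phi> g) \<le> C * torus_norm n g"
    using bounded_form_estimate[OF \<phi>] by blast
  define T where "T g = twisted_conv q (twisted_conv q (conv_star f) g) f" for g
  have sf: "conv_star f \<in> schwartz" by (rule conv_star_closed[OF f])
  have T: "bounded_operator T"
    unfolding T_def
    by (rule bounded_operator_comp[OF bounded_operator_conv_right[OF f] bounded_operator_conv_left[OF sf]])
  obtain k B where B: "B \<ge> 0" "\<And>g. g \<in> schwartz \<Longrightarrow> torus_norm n (T g) \<le> B * torus_norm k g"
    using bounded_operator_estimate[OF T, of n] by blast
  have T_add: "T (\<lambda>x. g x + h x) = (\<lambda>x. T g x + T h x)" if "g \<in> schwartz" "h \<in> schwartz" for g h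
    using that f sf by (simp add: T_def conv_add_left conv_add_right conv_closed)
  have T_cmult: "T (\<lambda>x. c * g x) = (\<lambda>x. c * T g x)" for c g
    by (simp add: T_def conv_cmult_left conv_cmult_right)
  have T_star: "T (twisted_conv q (conv_star g) g) =
      twisted_conv q (conv_star (twisted_conv q g f)) (twisted_conv q g f)" if "g \<in> schwartz" for g
    using that f sf by (simp add: T_def conv_star_conv conv_assoc conv_closed conv_star_closed)
  have act: "form_action (nc_torus q) f \<phi> = (\<lambda>g\<in>schwartz. \<phi> (T g))"
    by (simp add: form_action_def T_def)
  note Tc = bounded_operator_closed[OF T]
  have "form_action (nc_torus q) f \<phi> \<in> positive_forms (nc_torus q)"
    using f by (auto simp: act positive_forms_def linear_forms_def schwartz_add(1) schwartz_cmult(1)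
        T_add T_cmult T_star lin Tc conv_closed conv_star_closed)
  moreover have "cmod (form_action (nc_torus q) f \<phi> g) \<le> C * B * torus_norm k g" if g: "g \<in> schwartz" for g
    using C(2)[OF Tc[OF g]] mult_left_mono[OF B(2)[OF g] C(1)] g by (simp add: act mult.assoc)
  ultimately show ?thesis
    unfolding bounded_forms_def using mult_nonneg_nonneg[OF C(1) B(1)] by blast
qed

section \<open>Comparison of the two topologies\<close>

lemma derivation_composition_bounded:
  assumes "Xs \<in> lists bounded_derivations"
  shows "bounded_operator (foldr (\<circ>) Xs id)"
  using assms
proof (induction Xs)
  case Nil
  show ?case using bounded_operator_cmult[of 1] by (simp add: id_def)
next
  case (Cons X Xs)
  have "foldr (\<circ>) (X # Xs) id = (\<lambda>f. X (foldr (\<circ>) Xs id f))"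
    by (rule ext) simp
  moreover have "bounded_operator (\<lambda>f. X (foldr (\<circ>) Xs id f))"
    by (rule bounded_operator_comp) (use Cons in \<open>simp_all add: bounded_derivations_def\<close>)
  ultimately show ?case by (simp only:)
qed

lemma derivation_composition_add:
  assumes "Xs \<in> lists bounded_derivations" "f \<in> schwartz" "g \<in> schwartz"
  shows "foldr (\<circ>) Xs id (\<lambda>x. f x + g x) = (\<lambda>x. foldr (\<circ>) Xs id f x + foldr (\<circ>) Xs id g x)"
  using assms(1)
proof (induction Xs)
  case (Cons X Xs)
  then have Xs: "Xs \<in> lists bounded_derivations" and X: "X \<in> derivations (nc_torus q)"
    by (auto simp: bounded_derivations_def)
  note closed = bounded_operator_closed[OF derivation_composition_bounded[OF Xs]]
  have cons: "foldr (\<circ>) (X # Xs) id h = X (foldr (\<circ>) Xs id h)" for h by simp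
  show ?case
    unfolding cons Cons.IH
    by (rule derivationD(2)[OF X closed[OF assms(2)] closed[OF assms(3)]])
qed simp

lemma derivation_composition_zero:
  assumes "Xs \<in> lists bounded_derivations"
  shows "foldr (\<circ>) Xs id (\<lambda>_. 0) = (\<lambda>_. 0)"
  using assms
proof (induction Xs)
  case (Cons X Xs)
  then have "X (\<lambda>x. 0 * (0 :: complex)) = (\<lambda>_. 0)"
    using derivationD(3)[of X "\<lambda>_. 0" 0] by (simp add: bounded_derivations_def)
  then show ?case using Cons by simp
qed simp

text \<open>Continuity of the multiplication and the involution turns the bound on \<open>\<phi> (f\<^sup>* f)\<close> into a
  bound that is quadratic in a norm of \<open>f\<close>; the square root makes it linear.\<close>
lemma bounded_form_seminorm_estimate:
  assumes \<phi>: "\<phi> \<in> bounded_forms"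
  shows "\<exists>n M. M \<ge> 0 \<and>
    (\<forall>f\<in>schwartz. form_seminorm (nc_torus q) \<phi> f \<le> M * torus_norm n f)"
proof -
  obtain n C where C: "C \<ge> 0" "\<And>f. f \<in> schwartz \<Longrightarrow> cmod (\<phi> f) \<le> C * torus_norm n f"
    using bounded_form_estimate[OF \<phi>] by blast
  have "form_seminorm (nc_torus q) \<phi> f \<le> sqrt (C * weight_mass) * torus_norm (n + 4) f"
    if f: "f \<in> schwartz" for f
  proof -
    note nn = torus_norm_nonneg[OF f] torus_norm_nonneg[OF conv_star_closed[OF f]]
    have "Re (\<phi> (twisted_conv q (conv_star f) f)) \<le> cmod (\<phi> (twisted_conv q (conv_star f) f))"
      by (rule complex_Re_le_cmod)
    also have "\<dots> \<le> C * torus_norm n (twisted_conv q (conv_star f) f)"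
      by (rule C(2)) (simp add: f conv_closed conv_star_closed)
    also have "\<dots> \<le> C * (weight_mass * torus_norm (n + 4) (conv_star f) * torus_norm n f)"
      by (intro mult_left_mono conv_norm conv_star_closed f C(1))
    also have "\<dots> \<le> C * (weight_mass * torus_norm (n + 4) f * torus_norm (n + 4) f)"
      by (intro mult_left_mono mult_mono conv_star_norm f torus_norm_mono C(1) weight_mass_nonneg
          mult_nonneg_nonneg nn) auto
    also have "\<dots> = C * weight_mass * (torus_norm (n + 4) f)\<^sup>2"
      by (simp add: power2_eq_square)
    finally have "sqrt (Re (\<phi> (twisted_conv q (conv_star f) f))) \<le>
        sqrt (C * weight_mass * (torus_norm (n + 4) f)\<^sup>2)"
      by (rule real_sqrt_le_mono)
    also have "\<dots> = sqrt (C * weight_mass) * torus_norm (n + 4) f"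
      using nn(1)[of "n + 4"] by (simp add: real_sqrt_mult)
    finally show ?thesis by (simp add: form_seminorm_def)
  qed
  moreover have "sqrt (C * weight_mass) \<ge> 0"
    using C(1) weight_mass_nonneg by simp
  ultimately show ?thesis by blast
qed

lemma form_seminorm_subadditive:
  assumes "\<phi> \<in> bounded_forms" "f \<in> schwartz" "g \<in> schwartz"
  shows "form_seminorm (nc_torus q) \<phi> (\<lambda>x. f x + g x) \<le>
    form_seminorm (nc_torus q) \<phi> f + form_seminorm (nc_torus q) \<phi> g"
  using torus.form_seminorm_triangle[of \<phi> f g] assms by (simp add: bounded_forms_def)

lemma form_seminorm_zero:
  assumes "\<phi> \<in> bounded_forms"
  shows "form_seminorm (nc_torus q) \<phi> (\<lambda>_. 0) = 0"
proof -
  have "\<phi> (\<lambda>x. 0 * (0 :: complex)) = 0"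
    using assms torus.form_smult[of \<phi> "\<lambda>_. 0" 0] by (simp add: bounded_forms_def positive_forms_def)
  moreover have "twisted_conv q (conv_star (\<lambda>_. 0)) (\<lambda>_. 0) = (\<lambda>_. 0)"
    by (simp add: twisted_conv_def fun_eq_iff)
  ultimately show ?thesis by (simp add: form_seminorm_def)
qed

abbreviation torus_smooth_seminorms :: "((int \<times> int \<Rightarrow> complex) \<Rightarrow> real) set" where
  "torus_smooth_seminorms \<equiv> smooth_seminorms (nc_torus q) bounded_forms bounded_derivations"

lemma smooth_seminorm_form:
  assumes "p \<in> torus_smooth_seminorms"
  shows "\<exists>\<phi> Xs. \<phi> \<in> bounded_forms \<and> Xs \<in> lists bounded_derivations \<and>
    (\<forall>f. p f = form_seminorm (nc_torus q) \<phi> (foldr (\<circ>) Xs id f))"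
  using assms unfolding smooth_seminorms_def o_def by blast

lemma subadditive_form: "subadditive (nc_torus q) (form_seminorm (nc_torus q) ` bounded_forms)"
  by (auto simp: subadditive_def form_seminorm_subadditive form_seminorm_zero)

lemma subadditive_smooth: "subadditive (nc_torus q) torus_smooth_seminorms"
  unfolding subadditive_def
proof (intro ballI conjI)
  fix p assume p_in: "p \<in> torus_smooth_seminorms"
  obtain \<phi> Xs where \<phi>: "\<phi> \<in> bounded_forms" and Xs: "Xs \<in> lists bounded_derivations"
    and p: "\<And>f. p f = form_seminorm (nc_torus q) \<phi> (foldr (\<circ>) Xs id f)"
    using smooth_seminorm_form[OF p_in] by blast
  note closed = bounded_operator_closed[OF derivation_composition_bounded[OF Xs]]
  show "p \<zero>\<^bsub>nc_torus q\<^esub> = 0"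
    by (simp add: p derivation_composition_zero[OF Xs] form_seminorm_zero[OF \<phi>])
  fix f g assume "f \<in> carrier (nc_torus q)" "g \<in> carrier (nc_torus q)"
  then show "p (f \<oplus>\<^bsub>nc_torus q\<^esub> g) \<le> p f + p g"
    by (simp add: p derivation_composition_add[OF Xs] form_seminorm_subadditive[OF \<phi>] closed)
qed

lemma smooth_dominated: "dominated (nc_torus q) torus_smooth_seminorms (range torus_norm)"
  unfolding dominated_def
proof (intro ballI allI impI)
  fix p and e :: real assume p_in: "p \<in> torus_smooth_seminorms" and e: "e > 0"
  obtain \<phi> Xs where \<phi>: "\<phi> \<in> bounded_forms" and Xs: "Xs \<in> lists bounded_derivations"
    and p: "\<And>f. p f = form_seminorm (nc_torus q) \<phi> (foldr (\<circ>) Xs id f)"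
    using smooth_seminorm_form[OF p_in] by blast
  note X = derivation_composition_bounded[OF Xs]
  obtain n M where M: "M \<ge> 0"
    "\<And>f. f \<in> schwartz \<Longrightarrow> form_seminorm (nc_torus q) \<phi> f \<le> M * torus_norm n f"
    using bounded_form_seminorm_estimate[OF \<phi>] by blast
  obtain k C where C: "C \<ge> 0"
    "\<And>f. f \<in> schwartz \<Longrightarrow> torus_norm n (foldr (\<circ>) Xs id f) \<le> C * torus_norm k f"
    using bounded_operator_estimate[OF X, of n] by blast
  have MC: "M * C \<ge> 0" using M(1) C(1) by simp
  show "\<exists>Q0 d. finite Q0 \<and> Q0 \<subseteq> range torus_norm \<and> d > 0 \<and>
      (\<forall>f\<in>carrier (nc_torus q). (\<forall>r\<in>Q0. r f < d) \<longrightarrow> p f < e)"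
  proof (intro exI[of _ "{torus_norm k}"] exI[of _ "e / (M * C + 1)"] conjI ballI impI)
    show "e / (M * C + 1) > 0" using e MC by simp
    fix f assume "f \<in> carrier (nc_torus q)" and f_small: "\<forall>r\<in>{torus_norm k}. r f < e / (M * C + 1)"
    then have f: "f \<in> schwartz" by simp
    have "p f \<le> M * torus_norm n (foldr (\<circ>) Xs id f)"
      unfolding p by (rule M(2)[OF bounded_operator_closed[OF X f]])
    also have "\<dots> \<le> M * (C * torus_norm k f)"
      by (intro mult_left_mono C(2) f M(1))
    also have "\<dots> \<le> (M * C + 1) * torus_norm k f"
      using torus_norm_nonneg[OF f, of k] by (simp add: algebra_simps)
    also have "\<dots> < e"
      using f_small MC by (simp add: field_simps)
    finally show "p f < e" .
  qed auto
qed

lemma weight_power_le: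
  "weight x ^ m \<le> 3 ^ m * (1 + \<bar>real_of_int (fst x)\<bar> ^ m + \<bar>real_of_int (snd x)\<bar> ^ m)"
proof -
  define M where "M = max 1 (max \<bar>real_of_int (fst x)\<bar> \<bar>real_of_int (snd x)\<bar>)"
  have "weight x ^ m \<le> (3 * M) ^ m"
    by (intro power_mono) (auto simp: weight_def M_def)
  also have "M ^ m \<le> 1 + \<bar>real_of_int (fst x)\<bar> ^ m + \<bar>real_of_int (snd x)\<bar> ^ m"
    unfolding M_def by (auto simp: max_def)
  then have "(3 * M) ^ m \<le> 3 ^ m * (1 + \<bar>real_of_int (fst x)\<bar> ^ m + \<bar>real_of_int (snd x)\<bar> ^ m)"
    by (simp add: power_mult_distrib)
  finally show ?thesis .
qed

text \<open>The weight \<open>(1 + \<bar>k\<bar> + \<bar>l\<bar>)\<^sup>m\<close> splits, up to the factor \<open>3\<^sup>m\<close>, into \<open>1\<close>, \<open>\<bar>k\<bar>\<^sup>m\<close> and \<open>\<bar>l\<bar>\<^sup>m\<close>;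
  each of them acts on coefficients as a composition of derivations, followed by the
  coefficient bound for the trace.\<close>
lemma torus_norm_dominated: "dominated (nc_torus q) (range torus_norm) torus_smooth_seminorms"
  unfolding dominated_def
proof (intro ballI allI impI)
  fix p and e :: real assume "p \<in> range torus_norm" and e: "e > 0"
  then obtain m where p: "p = torus_norm m" by blast
  define P where "P Xs = form_seminorm (nc_torus q) torus_trace \<circ> foldr (\<circ>) Xs id" for Xs
  define X1 X2 where "X1 = replicate m (grading_derivation fst)"
    and "X2 = replicate m (grading_derivation snd)"
  have X: "X1 \<in> lists bounded_derivations" "X2 \<in> lists bounded_derivations"
    using fst_derivation snd_derivation by (auto simp: X1_def X2_def in_lists_conv_set)
  have P: "P Xs \<in> torus_smooth_seminorms" if "Xs \<in> lists bounded_derivations" for Xs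
    using that torus_trace_bounded unfolding P_def smooth_seminorms_def by blast
  \<comment> \<open>three terms of size at most \<open>?d\<close>, weighted by \<open>3 ^ m\<close>, add up to \<open>e / 2\<close>; the supremum must stay strictly below \<open>e\<close>\<close>
  let ?d = "e / (6 * 3 ^ m)"
  show "\<exists>Q0 d. finite Q0 \<and> Q0 \<subseteq> torus_smooth_seminorms \<and> d > 0 \<and>
      (\<forall>f\<in>carrier (nc_torus q). (\<forall>r\<in>Q0. r f < d) \<longrightarrow> p f < e)"
  proof (intro exI[of _ "{P [], P X1, P X2}"] exI[of _ ?d] conjI ballI impI)
    show "{P [], P X1, P X2} \<subseteq> torus_smooth_seminorms" using P X by simp
    show "?d > 0" using e by simp
    fix f assume "f \<in> carrier (nc_torus q)" and f_small: "\<forall>r\<in>{P [], P X1, P X2}. r f < ?d"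
    then have f: "f \<in> schwartz" by simp
    have "cmod (f x) * weight x ^ m \<le> e / 2" for x
    proof -
      have "cmod (f x) \<le> P [] f"
        using trace_seminorm_coeff[OF f] by (simp add: P_def)
      moreover have "cmod (of_int (fst x) ^ m * f x) \<le> P X1 f"
        using trace_seminorm_coeff[of "\<lambda>x. of_int (fst x) ^ m * f x" x]
          grading_derivation_iterate[OF fst_derivation f, of m] by (simp add: P_def X1_def)
      moreover have "cmod (of_int (snd x) ^ m * f x) \<le> P X2 f"
        using trace_seminorm_coeff[of "\<lambda>x. of_int (snd x) ^ m * f x" x]
          grading_derivation_iterate[OF snd_derivation f, of m] by (simp add: P_def X2_def)
      ultimately have small: "cmod (f x) \<le> ?d" "\<bar>real_of_int (fst x)\<bar> ^ m * cmod (f x) \<le> ?d"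
          "\<bar>real_of_int (snd x)\<bar> ^ m * cmod (f x) \<le> ?d"
        using f_small by (auto simp: norm_mult norm_power)
      have "cmod (f x) * weight x ^ m \<le> cmod (f x) *
          (3 ^ m * (1 + \<bar>real_of_int (fst x)\<bar> ^ m + \<bar>real_of_int (snd x)\<bar> ^ m))"
        by (intro mult_left_mono weight_power_le) simp
      also have "\<dots> = 3 ^ m * (cmod (f x) + \<bar>real_of_int (fst x)\<bar> ^ m * cmod (f x) +
          \<bar>real_of_int (snd x)\<bar> ^ m * cmod (f x))"
        by (simp add: algebra_simps)
      also have "\<dots> \<le> 3 ^ m * (?d + ?d + ?d)"
        by (intro mult_left_mono add_mono small) simp
      finally show ?thesis by (simp add: field_simps)
    qed
    then have "p f \<le> e / 2" unfolding p by (rule torus_norm_least)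
    then show "p f < e" using e by simp
  qed simp
qed

lemma torus_hausdorff:
  "Hausdorff_space (seminorm_topology (nc_torus q) (form_seminorm (nc_torus q) ` bounded_forms))"
proof (rule torus.Hausdorff_seminorm_topology[OF subadditive_form])
  fix f assume "f \<in> carrier (nc_torus q)" "f \<noteq> \<zero>\<^bsub>nc_torus q\<^esub>"
  then have f: "f \<in> schwartz" and "\<exists>x. f x \<noteq> 0" by (auto simp: fun_eq_iff)
  then obtain x where "f x \<noteq> 0" by blast
  then have "form_seminorm (nc_torus q) torus_trace f > 0"
    using trace_seminorm_coeff[OF f, of x] by (smt (verit) zero_less_norm_iff)
  moreover have "form_seminorm (nc_torus q) torus_trace (\<lambda>x. - g x) =
      form_seminorm (nc_torus q) torus_trace g" if "g \<in> schwartz" for g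
    using torus_trace_square(1)[OF that] torus_trace_square(1)[OF schwartz_uminus[OF that]]
    by (simp add: form_seminorm_def)
  ultimately show "\<exists>p\<in>form_seminorm (nc_torus q) ` bounded_forms. p f > 0 \<and>
      (\<forall>g\<in>carrier (nc_torus q). p (\<ominus>\<^bsub>nc_torus q\<^esub> g) = p g)"
    using torus_trace_bounded by auto
qed

lemma smooth_star_algebra_nc_torus:
  "smooth_star_algebra (nc_torus q) bounded_forms bounded_derivations"
proof (intro smooth_star_algebra.intro smooth_star_algebra_axioms.intro star_algebra_nc_torus)
  show "bounded_forms \<subseteq> positive_forms (nc_torus q)" by (auto simp: bounded_forms_def)
  show "form_action (nc_torus q) f \<phi> \<in> bounded_forms"
    if "f \<in> carrier (nc_torus q)" "\<phi> \<in> bounded_forms" for f \<phi>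
    using that by (simp add: bounded_forms_invariant)
  have sub: "bounded_derivations \<subseteq> derivations (nc_torus q)" by (auto simp: bounded_derivations_def)
  have comm: "(\<lambda>f\<in>schwartz. X (Y f) \<ominus>\<^bsub>nc_torus q\<^esub> Y (X f)) \<in> bounded_derivations"
    if "X \<in> bounded_derivations" "Y \<in> bounded_derivations" for X Y
  proof -
    have "Y (X f) \<in> schwartz" if "f \<in> schwartz" for f
      using that \<open>X \<in> _\<close> \<open>Y \<in> _\<close> by (simp add: bounded_derivations_def bounded_operator_closed)
    then show ?thesis
      using commutator_derivation[OF that] by (simp cong: restrict_cong)
  qed
  show "lie_subalgebra_Der (nc_torus q) bounded_derivations"
    unfolding lie_subalgebra_Der_def
    using sub zero_derivation add_derivation cmult_derivation comm by simp
  show "center_submodule_Der (nc_torus q) bounded_derivations"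
    unfolding center_submodule_Der_def
    using sub zero_derivation add_derivation center_derivation by simp
  show "seminorm_complete (nc_torus q) torus_smooth_seminorms"
    by (rule torus.seminorm_complete_transfer[OF subadditive_smooth subadditive_torus_norm
          smooth_dominated torus_norm_dominated torus_norm_complete])
qed (rule torus_hausdorff torus_common_kernel)+

lemma smooth_topology_nc_torus:
  "smooth_topology (nc_torus q) bounded_forms bounded_derivations = torus_frechet_topology q"
  unfolding smooth_topology_def torus_frechet_topology_def
  by (rule torus.seminorm_topology_eqI[OF subadditive_smooth subadditive_torus_norm
        smooth_dominated torus_norm_dominated])

end

theorem mainTheorem2:
  fixes q :: complex
  assumes "cmod q = 1"
  shows "\<exists>S D. smooth_star_algebra (nc_torus q) S D \<and>
               smooth_topology (nc_torus q) S D = torus_frechet_topology q"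
proof -
  interpret unitary_parameter q by unfold_locales (rule assms)
  show ?thesis
    using smooth_star_algebra_nc_torus smooth_topology_nc_torus by blast
qed

end
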